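(* Let $\nu\in\aleph$. Then $$\bar H_R(\nu)=\sum_{w\in\tilde W_{\min};\ \pi(w)=\nu}\bar H_w,$$ where $\bar H_w$ is the image in $\bar H_R$ of the $R$-submodule $H_w\subset H_R$ consisting of locally constant functions supported in $\mathcal I\dot w\mathcal I$.
   Context: Groups. $F$ is a nonarchimedean local field of arbitrary characteristic, with finite residue field of characteristic $p$; $\mathbb G$ is a connected reductive group over $F$ and $G=\mathbb G(F)$. $A$ is a fixed maximal $F$-split torus, $\mathscr A$ its apartment, $\mathfrak a_C\subset\mathscr A$ a fixed alcove, $\mathcal I$ the associated Iwahori subgroup. $Z$ is the centralizer of $A$, $N_GA$ its normalizer, $W_0=N_GA(F)/Z(F)$ the relative Weyl group, $Z_0$ the unique parahoric subgroup of $Z(F)$, and $\tilde W=N_GA(F)/Z_0$ the Iwahori-Weyl group. For $w\in\tilde W$, $\dot w$ denotes a lift of $w$ to $N_GA(F)$; $G=\bigsqcup_{w\in\tilde W}\mathcal I\dot w\mathcal I$. $G_0\subset G$ is the subgroup generated by all parahoric subgroups, $N_0A=G_0\cap N_GA(F)$, $\tilde{\mathbb S}$ is the set of simple reflections at the walls of $\mathfrak a_C$, and $W_a=N_0A/(N_0A\cap\mathcal I)$ is the affine Weyl group, a Coxeter group with generators $\tilde{\mathbb S}$. One has $\tilde W=W_a\rtimes\Omega$, where $\Omega$ is the stabilizer of $\mathfrak a_C$ in $\tilde W$; the length function $\ell$ on $W_a$ extends to $\tilde W$ with $\ell=0$ on $\Omega$. Let $V=X_*(Z)_{\mathrm{Gal}(\bar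 F/F)}\otimes\mathbb R$, where $\bar F$ is the completion of a separable closure of $F$, $X_*$ denotes cocharacters and the subscript denotes coinvariants. Choosing a special vertex of $\mathfrak a_C$ identifies $\mathscr A$ with the affine space underlying $V$, and $\tilde W\cong X_*(Z)_{\mathrm{Gal}(\bar F/F)}\rtimes W_0=\{t^\lambda w:\lambda\in X_*(Z)_{\mathrm{Gal}(\bar F/F)},\,w\in W_0\}$. Twist. $\theta$ is an automorphism of $G$ that stabilizes $A$ and $\mathcal I$; the induced affine transformation of $V$ and length-preserving automorphism of $\tilde W$ are also denoted $\theta$, and both actions are assumed to be of finite order. $\theta$-twisted conjugation is $g\cdot_\theta g'=gg'\theta(g)^{-1}$ on $G$ and $w\cdot_\theta w'=ww'\theta(w)^{-1}$ on $\tilde W$. Newton invariants. $\Omega_\theta$ is the set of $\theta$-coinvariants of $\Omega$, and $\kappa:\tilde W\to\tilde W/W_a\cong\Omega\to\Omega_\theta$ is the projection. For $w\in\tilde W$, choose a positive integer $n$ and $\lambda\in X_*(Z)_{\mathrm{Gal}(\bar F/F)}$ with $(w\theta)^n=t^\lambda$ in $\tilde W\rtimes\langle\theta\rangle$; set $\nu_w=\lambda/n\in V$ (independent of the choice of $n$), and let $\bar\nu_w$ be the unique dominant element of the $W_0$-orbit of $\nu_w$. Let $V_+$ be the set of dominant elements of $V$ and $\aleph=\Omega_\theta\times V_+$. The map $\pi=(\kappa,\bar\nu):\tilde W\to\aleph$ is constant on $\theta$-twisted conjugacy classes. $\tilde W_{\min}$ is the set of elements of $\tilde W$ of minimal length in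 their $\theta$-twisted conjugacy classes. Newton strata. For $\nu\in\aleph$, $X_\nu=\bigcup_{w\in\tilde W_{\min},\,\pi(w)=\nu}\mathcal I\dot w\mathcal I$ and $G(\nu)=G\cdot_\theta X_\nu=\{gx\theta(g)^{-1}:g\in G,x\in X_\nu\}$. Hecke algebra and cocenter. $\mu_G$ is the $\mathbb Z[\frac1p]$-valued Haar measure on $G$ with $\mu_G(\mathcal K)=[\mathcal K:\mathcal K\cap\mathcal I']/[\mathcal I':\mathcal K\cap\mathcal I']$ for open compact subgroups $\mathcal K$, where $\mathcal I'$ is the pro-$p$ Iwahori subgroup. $R$ is a commutative $\mathbb Z[\frac1p]$-algebra, and $H_R$ is the algebra of locally constant compactly supported $R$-valued functions on $G$ under convolution with respect to $\mu_G$. $\omega:G\to R^\times$ is a homomorphism with open kernel. $[H_R,H_R]_{\theta,\omega}$ is the $R$-span of the elements $\mathbb 1_X\mathbb 1_{X'}-\omega(X)^{-1}\mathbb 1_{X'}\mathbb 1_{\theta(X)}$ with $X,X'$ open compact subsets of $G$ such that $\omega|_X$ is constant (with value $\omega(X)$), where $\mathbb 1_Y$ is the characteristic function of $Y$; equivalently, the span of all $f-{}^xf$ with $f\in H_R$, $x\in G$, where ${}^xf(g)=\omega(x)f(x^{-1}g\theta(x))$. The $(\theta,\omega)$-twisted cocenter is $\bar H_R=H_R/[H_R,H_R]_{\theta,\omega}$. $H_R(\nu)\subset H_R$ is the $R$-submodule of functions supported in $G(\nu)$, and $\bar H_R(\nu)$ is its image in $\bar H_R$. *)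

theory Defs
  imports
    "HOL-Analysis.Analysis"
    "HOL-Algebra.Generated_Groups"
    "HOL-Library.Function_Algebras"
begin

section \<open>Nonarchimedean local fields\<close>

text \<open>
  The type \<open>'k\<close> is an algebraic closure of the local field, and the local field itself, as well as
  every intermediate field, is a subset of \<open>'k\<close>.  The valuation \<open>val\<close> is meaningful on nonzero
  elements of \<open>F\<close> only.
\<close>

definition is_subfield :: "'k::field set \<Rightarrow> bool" where
  "is_subfield F \<longleftrightarrow> 0 \<in> F \<and> 1 \<in> F \<and>
     (\<forall>x\<in>F. \<forall>y\<in>F. x - y \<in> F \<and> x * y \<in> F) \<and> (\<forall>x\<in>F. inverse x \<in> F)"

definition near :: "('k::field \<Rightarrow> int) \<Rightarrow> int \<Rightarrow> 'k \<Rightarrow> 'k \<Rightarrow> bool" where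
  "near val m x y \<longleftrightarrow> x = y \<or> m \<le> val (x - y)"

definition local_field :: "nat \<Rightarrow> 'k::field set \<Rightarrow> ('k \<Rightarrow> int) \<Rightarrow> bool" where
  "local_field p F val \<longleftrightarrow> is_subfield F \<and> prime p \<and>
     (\<forall>x\<in>F - {0}. \<forall>y\<in>F - {0}. val (x * y) = val x + val y \<and>
        (x + y \<noteq> 0 \<longrightarrow> min (val x) (val y) \<le> val (x + y))) \<and>
     (\<exists>x\<in>F - {0}. val x = 1) \<and>
     (\<forall>s :: nat \<Rightarrow> 'k. range s \<subseteq> F \<and> (\<forall>m. \<exists>N. \<forall>i\<ge>N. \<forall>j\<ge>N. near val m (s i) (s j)) \<longrightarrow>
        (\<exists>x\<in>F. \<forall>m. \<exists>N. \<forall>i\<ge>N. near val m (s i) x)) \<and>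
     (\<exists>S. finite S \<and> S \<subseteq> F \<and> (\<forall>x\<in>F. near val 0 x 0 \<longrightarrow> (\<exists>s\<in>S. near val 1 x s))) \<and>
     near val 1 (of_nat p) 0"

definition algebraic_over :: "'k::field set \<Rightarrow> bool" where
  "algebraic_over F \<longleftrightarrow> (\<forall>x. \<exists>q. q \<noteq> 0 \<and> (\<forall>i. coeff q i \<in> F) \<and> poly q x = 0)"

definition integral_over :: "'k::field set \<Rightarrow> ('k \<Rightarrow> int) \<Rightarrow> 'k \<Rightarrow> bool" where
  "integral_over F val x \<longleftrightarrow>
     (\<exists>q. lead_coeff q = 1 \<and> (\<forall>i. coeff q i \<in> F \<and> near val 0 (coeff q i) 0) \<and> poly q x = 0)"

text \<open>Since the residue field is finite, the maximal unramified extension is obtained by adjoining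
  all roots of unity of order prime to \<open>p\<close>.\<close>

definition max_unramified :: "nat \<Rightarrow> 'k::field set \<Rightarrow> 'k set" where
  "max_unramified p F = \<Inter>{E. is_subfield E \<and> F \<subseteq> E \<and> (\<forall>x m. \<not> p dvd m \<and> x ^ m = 1 \<longrightarrow> x \<in> E)}"

definition gal :: "'k::field set \<Rightarrow> 'k set \<Rightarrow> ('k \<Rightarrow> 'k) set" where
  "gal k E = {\<sigma>. \<sigma> ` E = E \<and> (\<forall>x\<in>k. \<sigma> x = x) \<and> (\<forall>x. x \<notin> E \<longrightarrow> \<sigma> x = x) \<and>
     (\<forall>x\<in>E. \<forall>y\<in>E. \<sigma> (x + y) = \<sigma> x + \<sigma> y \<and> \<sigma> (x * y) = \<sigma> x * \<sigma> y)}"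

definition finite_galois :: "'k::field set \<Rightarrow> 'k set \<Rightarrow> bool" where
  "finite_galois k E \<longleftrightarrow> is_subfield k \<and> is_subfield E \<and> k \<subseteq> E \<and> finite (gal k E) \<and>
     (\<forall>x\<in>E. (\<forall>\<sigma>\<in>gal k E. \<sigma> x = x) \<longrightarrow> x \<in> k)"


section \<open>Linear algebraic groups\<close>

text \<open>
  A linear algebraic group is identified with its group of points over the algebraically closed
  field \<open>'k\<close>, a Zariski closed subgroup of the general linear group.  As \<open>'k\<close> is infinite,
  polynomials in the matrix entries may be identified with polynomial functions.
\<close>

type_synonym ('k, 'n) sqmat = "(('k, 'n) vec, 'n) vec"

inductive_set polyfun :: "'k::field set \<Rightarrow> (('k, 'n::finite) sqmat \<Rightarrow> 'k) set" for k where
  polyfun_const: "c \<in> k \<Longrightarrow> (\<lambda>_. c) \<in> polyfun k"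
| polyfun_coord: "(\<lambda>g. g $ i $ j) \<in> polyfun k"
| polyfun_add: "f \<in> polyfun k \<Longrightarrow> h \<in> polyfun k \<Longrightarrow> (\<lambda>g. f g + h g) \<in> polyfun k"
| polyfun_mult: "f \<in> polyfun k \<Longrightarrow> h \<in> polyfun k \<Longrightarrow> (\<lambda>g. f g * h g) \<in> polyfun k"

definition GLn :: "('k::field, 'n::finite) sqmat monoid" where
  "GLn = \<lparr>carrier = {g. det g \<noteq> 0}, monoid.mult = (**), one = mat 1\<rparr>"

definition points :: "'k set \<Rightarrow> ('k, 'n::finite) sqmat set \<Rightarrow> ('k, 'n) sqmat set" where
  "points k H = {g\<in>H. \<forall>i j. g $ i $ j \<in> k}"

definition zariski_closed :: "('k::field, 'n::finite) sqmat set \<Rightarrow> bool" where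
  "zariski_closed H \<longleftrightarrow> (\<exists>P\<subseteq>polyfun UNIV. H = {g\<in>carrier GLn. \<forall>f\<in>P. f g = 0})"

definition alg_group :: "('k::field, 'n::finite) sqmat set \<Rightarrow> bool" where
  "alg_group H \<longleftrightarrow> subgroup H GLn \<and> zariski_closed H"

definition zariski_connected :: "('k::field, 'n::finite) sqmat set \<Rightarrow> bool" where
  "zariski_connected H \<longleftrightarrow> \<not> (\<exists>H1 H2. zariski_closed H1 \<and> zariski_closed H2 \<and>
     H1 \<noteq> {} \<and> H2 \<noteq> {} \<and> H1 \<inter> H2 = {} \<and> H1 \<union> H2 = H)"

definition vanishing_ideal :: "('k::field, 'n::finite) sqmat set \<Rightarrow> (('k, 'n) sqmat \<Rightarrow> 'k) set" where
  "vanishing_ideal H = {f\<in>polyfun UNIV. \<forall>g\<in>H. f g = 0}"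

text \<open>Over imperfect fields this is stronger than being the zero set of polynomials over \<open>k\<close>.\<close>

definition defined_over :: "'k::field set \<Rightarrow> ('k, 'n::finite) sqmat set \<Rightarrow> bool" where
  "defined_over k H \<longleftrightarrow> (\<forall>f\<in>vanishing_ideal H. \<exists>T c. finite T \<and> T \<subseteq> vanishing_ideal H \<inter> polyfun k \<and>
     f = (\<lambda>g. \<Sum>h\<in>T. c h * h g))"

definition unipotent :: "('k::field, 'n::finite) sqmat set \<Rightarrow> bool" where
  "unipotent H \<longleftrightarrow> (\<forall>g\<in>H. \<exists>m::nat. (((**) (g - mat 1)) ^^ m) (mat 1) = 0)"

definition reductive :: "('k::field, 'n::finite) sqmat set \<Rightarrow> bool" where
  "reductive H \<longleftrightarrow> alg_group H \<and> (\<forall>U. alg_group U \<and> zariski_connected U \<and> unipotent U \<and>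
     U \<lhd> (GLn\<lparr>carrier := H\<rparr>) \<longrightarrow> U = {mat 1})"

definition split_torus :: "'k::field set \<Rightarrow> ('k, 'n::finite) sqmat set \<Rightarrow> bool" where
  "split_torus k S \<longleftrightarrow> alg_group S \<and> zariski_connected S \<and> defined_over k S \<and>
     (\<exists>g\<in>points k (carrier GLn). \<forall>s\<in>S. \<forall>i j. i \<noteq> j \<longrightarrow> (g ** s ** matrix_inv g) $ i $ j = 0)"

definition max_split_torus ::
    "'k::field set \<Rightarrow> ('k, 'n::finite) sqmat set \<Rightarrow> ('k, 'n) sqmat set \<Rightarrow> bool" where
  "max_split_torus k H S \<longleftrightarrow> split_torus k S \<and> S \<subseteq> H \<and>
     (\<forall>S'. split_torus k S' \<and> S \<subseteq> S' \<and> S' \<subseteq> H \<longrightarrow> S' = S)"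

definition centralizer ::
    "('k::field, 'n::finite) sqmat set \<Rightarrow> ('k, 'n) sqmat set \<Rightarrow> ('k, 'n) sqmat set" where
  "centralizer H S = {g\<in>H. \<forall>s\<in>S. g ** s = s ** g}"

text \<open>Characters of \<open>H\<close> rational over \<open>k\<close>, extended by \<open>0\<close> outside \<open>H\<close>.\<close>

definition characters ::
    "'k::field set \<Rightarrow> ('k, 'n::finite) sqmat set \<Rightarrow> (('k, 'n) sqmat \<Rightarrow> 'k) set" where
  "characters k H = {ch. (\<forall>g. g \<notin> H \<longrightarrow> ch g = 0) \<and> (\<forall>g\<in>H. ch g \<noteq> 0) \<and>
     (\<forall>g\<in>H. \<forall>h\<in>H. ch (g ** h) = ch g * ch h) \<and>
     (\<exists>f\<in>polyfun k. \<exists>m::nat. \<forall>g\<in>H. ch g * det g ^ m = f g)}"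

definition scale_mat :: "'k::field \<Rightarrow> ('k, 'n::finite) sqmat \<Rightarrow> ('k, 'n) sqmat" where
  "scale_mat c X = (\<chi> i j. c * X $ i $ j)"

text \<open>The tangent space at the identity: the linear term of \<open>f (1 + t X)\<close> vanishes for all
  \<open>f\<close> in the vanishing ideal.\<close>

definition lie_algebra :: "('k::field, 'n::finite) sqmat set \<Rightarrow> ('k, 'n) sqmat set" where
  "lie_algebra H = {X. \<forall>f\<in>vanishing_ideal H.
     \<exists>q. (\<forall>t. poly q t = f (mat 1 + scale_mat t X)) \<and> coeff q 1 = 0}"

definition weight_space :: "('k::field, 'n::finite) sqmat set \<Rightarrow> ('k, 'n) sqmat set \<Rightarrow>
    (('k, 'n) sqmat \<Rightarrow> 'k) \<Rightarrow> ('k, 'n) sqmat set" where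
  "weight_space H S a = {X\<in>lie_algebra H. \<forall>s\<in>S. s ** X ** matrix_inv s = scale_mat (a s) X}"

definition roots :: "('k::field, 'n::finite) sqmat set \<Rightarrow> ('k, 'n) sqmat set \<Rightarrow>
    (('k, 'n) sqmat \<Rightarrow> 'k) set" where
  "roots H S = {a\<in>characters UNIV S. (\<exists>s\<in>S. a s \<noteq> 1) \<and> weight_space H S a \<noteq> {0}}"

text \<open>The root group of \<open>a\<close> (Borel, Linear Algebraic Groups, 21.9): characters are written
  multiplicatively here, so the Lie algebra is the sum of the weight spaces for \<open>a\<close>
  and \<open>a\<^sup>2\<close>, usually written \<open>2a\<close>.\<close>

definition root_group :: "('k::field, 'n::finite) sqmat set \<Rightarrow> ('k, 'n) sqmat set \<Rightarrow>
    (('k, 'n) sqmat \<Rightarrow> 'k) \<Rightarrow> ('k, 'n) sqmat set" where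
  "root_group H S a = (THE U. alg_group U \<and> zariski_connected U \<and> unipotent U \<and> U \<subseteq> H \<and>
     (\<forall>z\<in>centralizer H S. (\<lambda>u. z ** u ** matrix_inv z) ` U = U) \<and>
     lie_algebra U = {X + Y |X Y. X \<in> weight_space H S a \<and> Y \<in> weight_space H S (\<lambda>s. a s * a s)})"


section \<open>The kernel of the Kottwitz homomorphism\<close>

text \<open>
  For a torus \<open>T\<close> over the maximal unramified extension \<open>L\<close> of \<open>F\<close>, split by a finite Galois
  extension \<open>E\<close> of \<open>L\<close>, the Kottwitz homomorphism from \<open>T(L)\<close> to the coinvariants of the
  cocharacter group is determined by the commutative square formed by the valuation map on \<open>T(E)\<close>,
  the norm (which is surjective on points) and the projection to coinvariants (Kottwitz, Isocrystals
  with additional structure II, section 7).  Its kernel is thus the group of norms of elements of the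
  maximal bounded subgroup of \<open>T(E)\<close>.  An element of the latter is one whose image under every
  character is integral over the ring of integers of \<open>F\<close>.  The norm is a product of
  commuting matrices, taken here along an arbitrary enumeration of the Galois group.
\<close>

definition torus_kottwitz_kernel ::
    "nat \<Rightarrow> 'k::field set \<Rightarrow> ('k \<Rightarrow> int) \<Rightarrow> ('k, 'n::finite) sqmat set \<Rightarrow> ('k, 'n) sqmat set" where
  "torus_kottwitz_kernel p F val T = (let L = max_unramified p F in
     {t. \<exists>E \<sigma>s y. finite_galois L E \<and> split_torus E T \<and> distinct \<sigma>s \<and> set \<sigma>s = gal L E \<and>
        y \<in> points E T \<and> (\<forall>ch\<in>characters UNIV T. integral_over F val (ch y)) \<and>
        t = foldr (\<lambda>\<sigma> x. (\<chi> i j. \<sigma> (y $ i $ j)) ** x) \<sigma>s (mat 1)})"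

text \<open>
  For connected reductive \<open>H\<close>, quasi-split over \<open>L\<close> by Steinberg's theorem, the kernel of
  the Kottwitz homomorphism on \<open>H(L)\<close> is generated by the kernel for the maximal torus centralizing
  a maximal \<open>L\<close>-split torus and by the \<open>L\<close>-points of the relative root groups (the image of
  the simply connected cover of the derived group).  The following is its intersection with
  \<open>H(F)\<close>.
\<close>

definition kottwitz_kernel ::
    "nat \<Rightarrow> 'k::field set \<Rightarrow> ('k \<Rightarrow> int) \<Rightarrow> ('k, 'n::finite) sqmat set \<Rightarrow> ('k, 'n) sqmat set" where
  "kottwitz_kernel p F val H = (let L = max_unramified p F in
     points F H \<inter> generate GLn
       (\<Union>S\<in>{S. max_split_torus L H S}.
          torus_kottwitz_kernel p F val (centralizer H S) \<union>
          (\<Union>a\<in>roots H S. points L (root_group H S a))))"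


section \<open>The data\<close>

text \<open>
  Let \<open>V\<close> be the real vector space of cocharacters of \<open>A\<close>, realised as the space of additive
  real functions on the character group of \<open>A\<close> (extended by \<open>0\<close>).  It is canonically
  the tensor product of the real numbers with the Galois coinvariants of the cocharacters of the
  centralizer \<open>Z\<close> of \<open>A\<close>.  The apartment is \<open>V\<close> with an affine action of
  \<open>N\<close>, the origin being a special vertex of the fixed alcove.  \<open>chamber_point\<close> is
  a regular vector, used to name the dominant Weyl chamber.
\<close>

type_synonym ('k, 'n) cochar_space = "(('k, 'n) sqmat \<Rightarrow> 'k) \<Rightarrow> real"

record ('k, 'n) padic_datum =
  residue_char :: nat
  base_field :: "'k set"
  valuation :: "'k \<Rightarrow> int"
  alg_grp :: "('k, 'n) sqmat set"
  max_torus :: "('k, 'n) sqmat set"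
  apartment_action :: "('k, 'n) sqmat \<Rightarrow> ('k, 'n) cochar_space \<Rightarrow> ('k, 'n) cochar_space"
  alcove :: "('k, 'n) cochar_space set"
  chamber_point :: "('k, 'n) cochar_space"
  twist :: "('k, 'n) sqmat \<Rightarrow> ('k, 'n) sqmat"

definition G_set :: "('k::field, 'n::finite) padic_datum \<Rightarrow> ('k, 'n) sqmat set" where
  "G_set D = points (base_field D) (alg_grp D)"

definition G_group :: "('k::field, 'n::finite) padic_datum \<Rightarrow> ('k, 'n) sqmat monoid" where
  "G_group D = GLn\<lparr>carrier := G_set D\<rparr>"

definition G_top :: "('k::field, 'n::finite) padic_datum \<Rightarrow> ('k, 'n) sqmat topology" where
  "G_top D = topology (\<lambda>U. U \<subseteq> G_set D \<and> (\<forall>g\<in>U. \<exists>m. \<forall>h\<in>G_set D.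
     (\<forall>i j. near (valuation D) m (h $ i $ j) (g $ i $ j)) \<longrightarrow> h \<in> U))"

definition N_set :: "('k::field, 'n::finite) padic_datum \<Rightarrow> ('k, 'n) sqmat set" where
  "N_set D = {g\<in>G_set D. (\<lambda>s. g ** s ** matrix_inv g) ` max_torus D = max_torus D}"

definition Z_alg :: "('k::field, 'n::finite) padic_datum \<Rightarrow> ('k, 'n) sqmat set" where
  "Z_alg D = centralizer (alg_grp D) (max_torus D)"

definition Z_set :: "('k::field, 'n::finite) padic_datum \<Rightarrow> ('k, 'n) sqmat set" where
  "Z_set D = points (base_field D) (Z_alg D)"

text \<open>The unique parahoric subgroup of \<open>Z(F)\<close> is the kernel of its Kottwitz homomorphism
  (Haines--Rapoport).\<close>

definition Z0 :: "('k::field, 'n::finite) padic_datum \<Rightarrow> ('k, 'n) sqmat set" where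
  "Z0 D = kottwitz_kernel (residue_char D) (base_field D) (valuation D) (Z_alg D)"

abbreviation rel_roots :: "('k::field, 'n::finite) padic_datum \<Rightarrow> (('k, 'n) sqmat \<Rightarrow> 'k) set" where
  "rel_roots D \<equiv> roots (alg_grp D) (max_torus D)"

definition U_root ::
    "('k::field, 'n::finite) padic_datum \<Rightarrow> (('k, 'n) sqmat \<Rightarrow> 'k) \<Rightarrow> ('k, 'n) sqmat set" where
  "U_root D a = G_set D \<inter> root_group (alg_grp D) (max_torus D) a"

definition V_space :: "('k::field, 'n::finite) padic_datum \<Rightarrow> ('k, 'n) cochar_space set" where
  "V_space D = {x. (\<forall>ch. ch \<notin> characters UNIV (max_torus D) \<longrightarrow> x ch = 0) \<and>
     (\<forall>ch\<in>characters UNIV (max_torus D). \<forall>\<psi>\<in>characters UNIV (max_torus D).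
        x (\<lambda>s. ch s * \<psi> s) = x ch + x \<psi>)}"

definition W0_act :: "('k::field, 'n::finite) sqmat \<Rightarrow> ('k, 'n) cochar_space \<Rightarrow> ('k, 'n) cochar_space" where
  "W0_act g x = (\<lambda>ch. x (\<lambda>s. ch (g ** s ** matrix_inv g)))"

text \<open>The translation of the apartment by which \<open>z \<in> Z(F)\<close> acts (Tits, Reductive groups over
  local fields, 1.2): its pairing with a rational character of \<open>Z\<close> is minus the valuation
  of the value at \<open>z\<close>.\<close>

definition transl :: "('k::field, 'n::finite) padic_datum \<Rightarrow> ('k, 'n) sqmat \<Rightarrow> ('k, 'n) cochar_space" where
  "transl D z = (THE x. x \<in> V_space D \<and> (\<forall>ch\<in>characters (base_field D) (Z_alg D).
     x (\<lambda>s. if s \<in> max_torus D then ch s else 0) = - of_int (valuation D (ch z))))"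

text \<open>Such an action exists and is unique up to translation (Tits, 1.2).\<close>

definition is_apartment_action :: "('k::field, 'n::finite) padic_datum \<Rightarrow> bool" where
  "is_apartment_action D \<longleftrightarrow>
     (\<forall>g\<in>N_set D. \<forall>x\<in>V_space D. apartment_action D g x \<in> V_space D) \<and>
     (\<forall>g\<in>N_set D. \<forall>h\<in>N_set D. \<forall>x\<in>V_space D.
        apartment_action D (g ** h) x = apartment_action D g (apartment_action D h x)) \<and>
     (\<forall>g\<in>N_set D. \<forall>x\<in>V_space D. \<forall>y\<in>V_space D.
        apartment_action D g x - apartment_action D g y = W0_act g (x - y)) \<and>
     (\<forall>z\<in>Z_set D. \<forall>x\<in>V_space D. apartment_action D z x = x + transl D z)"

text \<open>
  For a root \<open>a\<close> and \<open>u \<noteq> 1\<close> in \<open>U\<^sub>a(F)\<close> there is exactly one element of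
  \<open>N\<close> in the set \<open>U\<^sub>-\<^sub>a(F) u U\<^sub>-\<^sub>a(F)\<close>.  It acts as a reflection, and
  \<open>aff_fun D a u\<close> is the affine function with linear part \<open>a\<close> vanishing on the fixed
  hyperplane (Tits, 1.4).
\<close>

definition aff_fun :: "('k::field, 'n::finite) padic_datum \<Rightarrow> (('k, 'n) sqmat \<Rightarrow> 'k) \<Rightarrow>
    ('k, 'n) sqmat \<Rightarrow> ('k, 'n) cochar_space \<Rightarrow> real" where
  "aff_fun D a u x = (THE c. \<exists>v\<in>U_root D (\<lambda>s. inverse (a s)). \<exists>v'\<in>U_root D (\<lambda>s. inverse (a s)).
     \<exists>y\<in>V_space D. v ** u ** v' \<in> N_set D \<and> apartment_action D (v ** u ** v') y = y \<and> c = x a - y a)"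

definition root_elts ::
    "('k::field, 'n::finite) padic_datum \<Rightarrow> ((('k, 'n) sqmat \<Rightarrow> 'k) \<times> ('k, 'n) sqmat) set" where
  "root_elts D = {(a, u). a \<in> rel_roots D \<and> u \<in> U_root D a \<and> u \<noteq> mat 1}"

definition hyperplanes :: "('k::field, 'n::finite) padic_datum \<Rightarrow> ('k, 'n) cochar_space set set" where
  "hyperplanes D = {{x\<in>V_space D. aff_fun D a u x = 0} |a u. (a, u) \<in> root_elts D}"

text \<open>Alcoves are the chambers of the hyperplane arrangement, i.e. the classes of points off all
  hyperplanes under the relation of lying on the same side of each of them.\<close>

definition is_alcove :: "('k::field, 'n::finite) padic_datum \<Rightarrow> ('k, 'n) cochar_space set \<Rightarrow> bool" where
  "is_alcove D C \<longleftrightarrow> (\<exists>x\<in>V_space D. x \<notin> \<Union>(hyperplanes D) \<and>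
     C = {y\<in>V_space D. \<forall>(a, u)\<in>root_elts D. aff_fun D a u x * aff_fun D a u y > 0})"

definition closed_alcove :: "('k::field, 'n::finite) padic_datum \<Rightarrow> ('k, 'n) cochar_space set" where
  "closed_alcove D = {y\<in>V_space D. \<forall>x\<in>alcove D. \<forall>(a, u)\<in>root_elts D.
     aff_fun D a u x * aff_fun D a u y \<ge> 0}"

definition is_special :: "('k::field, 'n::finite) padic_datum \<Rightarrow> ('k, 'n) cochar_space \<Rightarrow> bool" where
  "is_special D x \<longleftrightarrow> (\<forall>a\<in>rel_roots D. \<exists>u. (a, u) \<in> root_elts D \<and> aff_fun D a u x = 0)"

text \<open>The parahoric subgroup attached to a facet, or equivalently to one of its points.\<close>

definition parahoric ::
    "('k::field, 'n::finite) padic_datum \<Rightarrow> ('k, 'n) cochar_space set \<Rightarrow> ('k, 'n) sqmat set" where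
  "parahoric D Y = generate GLn (Z0 D \<union>
     {u. \<exists>a. (a, u) \<in> root_elts D \<and> (\<forall>x\<in>Y. aff_fun D a u x \<ge> 0)})"

definition iwahori :: "('k::field, 'n::finite) padic_datum \<Rightarrow> ('k, 'n) sqmat set" where
  "iwahori D = parahoric D (alcove D)"

text \<open>Every facet of the building is conjugate under \<open>G\<close> to one in the standard apartment.\<close>

definition G0 :: "('k::field, 'n::finite) padic_datum \<Rightarrow> ('k, 'n) sqmat set" where
  "G0 D = generate GLn (\<Union>g\<in>G_set D. \<Union>x\<in>V_space D.
     (\<lambda>h. g ** h ** matrix_inv g) ` parahoric D {x})"

definition is_padic_datum :: "('k::alg_closed_field, 'n::finite) padic_datum \<Rightarrow> bool" where
  "is_padic_datum D \<longleftrightarrow>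
     local_field (residue_char D) (base_field D) (valuation D) \<and> algebraic_over (base_field D) \<and>
     zariski_connected (alg_grp D) \<and> reductive (alg_grp D) \<and> defined_over (base_field D) (alg_grp D) \<and>
     max_split_torus (base_field D) (alg_grp D) (max_torus D) \<and>
     is_apartment_action D \<and> is_alcove D (alcove D) \<and>
     0 \<in> closed_alcove D \<and> is_special D 0 \<and>
     chamber_point D \<in> V_space D \<and> (\<forall>a\<in>rel_roots D. chamber_point D a \<noteq> 0)"


section \<open>The Iwahori--Weyl group\<close>

definition W_tilde :: "('k::field, 'n::finite) padic_datum \<Rightarrow> ('k, 'n) sqmat set monoid" where
  "W_tilde D = (GLn\<lparr>carrier := N_set D\<rparr>) Mod Z0 D"

definition W_theta :: "('k::field, 'n::finite) padic_datum \<Rightarrow> ('k, 'n) sqmat set \<Rightarrow> ('k, 'n) sqmat set" where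
  "W_theta D w = twist D ` w"

text \<open>The image of \<open>G\<^sub>0 \<inter> N\<close> in the Iwahori--Weyl group; this is the affine Weyl group
  because \<open>N\<close> meets the Iwahori subgroup in \<open>Z\<^sub>0\<close>.\<close>

definition W_aff :: "('k::field, 'n::finite) padic_datum \<Rightarrow> ('k, 'n) sqmat set set" where
  "W_aff D = {w\<in>carrier (W_tilde D). w \<subseteq> G0 D}"

definition alcove_walls :: "('k::field, 'n::finite) padic_datum \<Rightarrow> ('k, 'n) cochar_space set set" where
  "alcove_walls D = {H\<in>hyperplanes D. \<exists>y\<in>H \<inter> closed_alcove D. \<forall>H'\<in>hyperplanes D. y \<in> H' \<longrightarrow> H' = H}"

definition simple_refl :: "('k::field, 'n::finite) padic_datum \<Rightarrow> ('k, 'n) sqmat set set" where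
  "simple_refl D = {s\<in>W_aff D. \<exists>H\<in>alcove_walls D. \<forall>g\<in>s. {x\<in>V_space D. apartment_action D g x = x} = H}"

definition Omega :: "('k::field, 'n::finite) padic_datum \<Rightarrow> ('k, 'n) sqmat set set" where
  "Omega D = {w\<in>carrier (W_tilde D). \<forall>g\<in>w. apartment_action D g ` alcove D = alcove D}"

definition W_length :: "('k::field, 'n::finite) padic_datum \<Rightarrow> ('k, 'n) sqmat set \<Rightarrow> nat" where
  "W_length D w = (LEAST k. \<exists>ss \<tau>. length ss = k \<and> set ss \<subseteq> simple_refl D \<and> \<tau> \<in> Omega D \<and>
     w = foldr (monoid.mult (W_tilde D)) ss \<tau>)"

definition W_conj :: "('k::field, 'n::finite) padic_datum \<Rightarrow>
    ('k, 'n) sqmat set \<Rightarrow> ('k, 'n) sqmat set \<Rightarrow> ('k, 'n) sqmat set" where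
  "W_conj D x w = x \<otimes>\<^bsub>W_tilde D\<^esub> w \<otimes>\<^bsub>W_tilde D\<^esub> inv\<^bsub>W_tilde D\<^esub> (W_theta D x)"

definition W_min :: "('k::field, 'n::finite) padic_datum \<Rightarrow> ('k, 'n) sqmat set set" where
  "W_min D = {w\<in>carrier (W_tilde D). \<forall>x\<in>carrier (W_tilde D). W_length D w \<le> W_length D (W_conj D x w)}"

text \<open>The twist is a topological automorphism of \<open>G\<close>; the affine transformation \<open>\<psi>\<close> of the
  apartment which it induces is characterised by its compatibility with the action of \<open>N\<close> and
  by preserving the alcove.\<close>

definition is_twist :: "('k::field, 'n::finite) padic_datum \<Rightarrow> bool" where
  "is_twist D \<longleftrightarrow> twist D \<in> iso (G_group D) (G_group D) \<and> homeomorphic_map (G_top D) (G_top D) (twist D) \<and>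
     twist D ` points (base_field D) (max_torus D) = points (base_field D) (max_torus D) \<and>
     twist D ` iwahori D = iwahori D \<and>
     (\<forall>w\<in>carrier (W_tilde D). W_length D (W_theta D w) = W_length D w) \<and>
     (\<exists>k>0. \<forall>w\<in>carrier (W_tilde D). (W_theta D ^^ k) w = w) \<and>
     (\<exists>\<psi>. \<psi> ` V_space D \<subseteq> V_space D \<and>
        (\<forall>x\<in>V_space D. \<forall>y\<in>V_space D. \<forall>c.
           \<psi> (\<lambda>ch. c * x ch + (1 - c) * y ch) = (\<lambda>ch. c * \<psi> x ch + (1 - c) * \<psi> y ch)) \<and>
        (\<forall>g\<in>N_set D. \<forall>x\<in>V_space D.
           \<psi> (apartment_action D g x) = apartment_action D (twist D g) (\<psi> x)) \<and>
        \<psi> ` alcove D = alcove D \<and>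
        (\<exists>k>0. \<forall>x\<in>V_space D. (\<psi> ^^ k) x = x))"


section \<open>Newton invariants and Newton strata\<close>

definition Omega_aug :: "('k::field, 'n::finite) padic_datum \<Rightarrow> ('k, 'n) sqmat set set" where
  "Omega_aug D = generate (W_tilde D)
     {\<tau> \<otimes>\<^bsub>W_tilde D\<^esub> inv\<^bsub>W_tilde D\<^esub> (W_theta D \<tau>) |\<tau>. \<tau> \<in> Omega D}"

definition Omega_coinv :: "('k::field, 'n::finite) padic_datum \<Rightarrow> ('k, 'n) sqmat set set monoid" where
  "Omega_coinv D = (W_tilde D\<lparr>carrier := Omega D\<rparr>) Mod Omega_aug D"

definition kappa :: "('k::field, 'n::finite) padic_datum \<Rightarrow> ('k, 'n) sqmat set \<Rightarrow> ('k, 'n) sqmat set set" where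
  "kappa D w = (THE c. \<exists>x\<in>W_aff D. \<exists>\<tau>\<in>Omega D.
     w = x \<otimes>\<^bsub>W_tilde D\<^esub> \<tau> \<and> c = Omega_aug D #>\<^bsub>W_tilde D\<^esub> \<tau>)"

text \<open>\<open>twisted_power D w n\<close> is \<open>w \<theta>(w) \<dots> \<theta>\<^sup>n\<^sup>-\<^sup>1(w)\<close>, so that
  \<open>(w\<theta>)\<^sup>n = twisted_power D w n \<theta>\<^sup>n\<close> in the semidirect product.\<close>

primrec twisted_power ::
    "('k::field, 'n::finite) padic_datum \<Rightarrow> ('k, 'n) sqmat set \<Rightarrow> nat \<Rightarrow> ('k, 'n) sqmat set" where
  "twisted_power D w 0 = \<one>\<^bsub>W_tilde D\<^esub>"
| "twisted_power D w (Suc n) = twisted_power D w n \<otimes>\<^bsub>W_tilde D\<^esub> (W_theta D ^^ n) w"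

text \<open>The translation subgroup of the Iwahori--Weyl group is the image of \<open>Z(F)\<close>, and the class
  of \<open>z\<close> is the translation by \<open>transl D z\<close>.\<close>

definition newton :: "('k::field, 'n::finite) padic_datum \<Rightarrow> ('k, 'n) sqmat set \<Rightarrow> ('k, 'n) cochar_space" where
  "newton D w = (THE v. \<exists>n>0. \<exists>z\<in>Z_set D. (\<forall>x\<in>carrier (W_tilde D). (W_theta D ^^ n) x = x) \<and>
     twisted_power D w n = Z0 D #>\<^bsub>GLn\<^esub> z \<and> v = (\<lambda>ch. transl D z ch / of_nat n))"

definition V_dom :: "('k::field, 'n::finite) padic_datum \<Rightarrow> ('k, 'n) cochar_space set" where
  "V_dom D = {x\<in>V_space D. \<forall>a\<in>rel_roots D. chamber_point D a > 0 \<longrightarrow> x a \<ge> 0}"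

definition newton_dom :: "('k::field, 'n::finite) padic_datum \<Rightarrow> ('k, 'n) sqmat set \<Rightarrow> ('k, 'n) cochar_space" where
  "newton_dom D w = (THE v. v \<in> V_dom D \<and> (\<exists>g\<in>N_set D. v = W0_act g (newton D w)))"

definition aleph :: "('k::field, 'n::finite) padic_datum \<Rightarrow>
    (('k, 'n) sqmat set set \<times> ('k, 'n) cochar_space) set" where
  "aleph D = carrier (Omega_coinv D) \<times> V_dom D"

definition newton_pi :: "('k::field, 'n::finite) padic_datum \<Rightarrow> ('k, 'n) sqmat set \<Rightarrow>
    ('k, 'n) sqmat set set \<times> ('k, 'n) cochar_space" where
  "newton_pi D w = (kappa D w, newton_dom D w)"

text \<open>All lifts of \<open>w\<close> give the same double coset, since the Iwahori subgroup contains
  \<open>Z\<^sub>0\<close>.\<close>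

definition double_coset :: "('k::field, 'n::finite) padic_datum \<Rightarrow> ('k, 'n) sqmat set \<Rightarrow> ('k, 'n) sqmat set" where
  "double_coset D w = {i ** g ** j |i g j. i \<in> iwahori D \<and> g \<in> w \<and> j \<in> iwahori D}"

definition X_nu :: "('k::field, 'n::finite) padic_datum \<Rightarrow>
    ('k, 'n) sqmat set set \<times> ('k, 'n) cochar_space \<Rightarrow> ('k, 'n) sqmat set" where
  "X_nu D \<nu> = (\<Union>w\<in>{w\<in>W_min D. newton_pi D w = \<nu>}. double_coset D w)"

definition newton_stratum :: "('k::field, 'n::finite) padic_datum \<Rightarrow>
    ('k, 'n) sqmat set set \<times> ('k, 'n) cochar_space \<Rightarrow> ('k, 'n) sqmat set" where
  "newton_stratum D \<nu> = {g ** x ** matrix_inv (twist D g) |g x. g \<in> G_set D \<and> x \<in> X_nu D \<nu>}"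


section \<open>Haar measure, Hecke algebra and cocenter\<close>

definition open_compact :: "('k::field, 'n::finite) padic_datum \<Rightarrow> ('k, 'n) sqmat set \<Rightarrow> bool" where
  "open_compact D X \<longleftrightarrow> openin (G_top D) X \<and> compactin (G_top D) X"

definition group_index :: "('k::field, 'n::finite) sqmat set \<Rightarrow> ('k, 'n) sqmat set \<Rightarrow> nat" where
  "group_index K K' = card (rcosets\<^bsub>GLn\<lparr>carrier := K\<rparr>\<^esub> K')"

definition pro_p_group :: "('k::field, 'n::finite) padic_datum \<Rightarrow> ('k, 'n) sqmat set \<Rightarrow> bool" where
  "pro_p_group D P \<longleftrightarrow> subgroup P (G_group D) \<and> compactin (G_top D) P \<and>
     (\<forall>U\<subseteq>P. subgroup U (G_group D) \<and> openin (subtopology (G_top D) P) U \<longrightarrow>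
        (\<exists>k. group_index P U = residue_char D ^ k))"

text \<open>The pro-\<open>p\<close> Iwahori subgroup: the unique pro-\<open>p\<close> Sylow subgroup of the Iwahori subgroup.\<close>

definition is_pro_p_iwahori :: "('k::field, 'n::finite) padic_datum \<Rightarrow> ('k, 'n) sqmat set \<Rightarrow> bool" where
  "is_pro_p_iwahori D P \<longleftrightarrow> pro_p_group D P \<and> openin (G_top D) P \<and>
     P \<lhd> (GLn\<lparr>carrier := iwahori D\<rparr>) \<and> finite (rcosets\<^bsub>GLn\<lparr>carrier := iwahori D\<rparr>\<^esub> P) \<and>
     coprime (group_index (iwahori D) P) (residue_char D)"

text \<open>Only the values of the Haar measure on open compact subsets matter.  It is left and right
  invariant because reductive groups are unimodular.\<close>

definition is_haar :: "('k::field, 'n::finite) padic_datum \<Rightarrow> ('k, 'n) sqmat set \<Rightarrow>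
    (('k, 'n) sqmat set \<Rightarrow> rat) \<Rightarrow> bool" where
  "is_haar D P \<mu> \<longleftrightarrow>
     (\<forall>X. open_compact D X \<longrightarrow> (\<exists>a::int. \<exists>k::nat. \<mu> X = of_int a / of_nat (residue_char D) ^ k)) \<and>
     (\<forall>X Y. open_compact D X \<and> open_compact D Y \<and> X \<inter> Y = {} \<longrightarrow> \<mu> (X \<union> Y) = \<mu> X + \<mu> Y) \<and>
     (\<forall>X. \<forall>g\<in>G_set D. open_compact D X \<longrightarrow>
        \<mu> ((\<lambda>x. g ** x) ` X) = \<mu> X \<and> \<mu> ((\<lambda>x. x ** g) ` X) = \<mu> X) \<and>
     (\<forall>K. open_compact D K \<and> subgroup K (G_group D) \<longrightarrow>
        \<mu> K = of_nat (group_index K (K \<inter> P)) / of_nat (group_index P (K \<inter> P)))"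

text \<open>The structure homomorphism from the ring of rationals with \<open>p\<close>-power denominator to
  a commutative ring in which \<open>p\<close> is invertible.\<close>

definition of_Zp_inv :: "nat \<Rightarrow> rat \<Rightarrow> 'r::comm_ring_1" where
  "of_Zp_inv p q = (THE r. \<exists>a::int. \<exists>k::nat. q = of_int a / of_nat p ^ k \<and> r * of_nat p ^ k = of_int a)"

definition hecke :: "('k::field, 'n::finite) padic_datum \<Rightarrow> (('k, 'n) sqmat \<Rightarrow> 'r::comm_ring_1) set" where
  "hecke D = {f. (\<forall>g. g \<notin> G_set D \<longrightarrow> f g = 0) \<and>
     (\<forall>g\<in>G_set D. \<exists>U. openin (G_top D) U \<and> g \<in> U \<and> (\<forall>h\<in>U. f h = f g)) \<and>
     (\<exists>C. compactin (G_top D) C \<and> (\<forall>g. f g \<noteq> 0 \<longrightarrow> g \<in> C))}"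

definition hecke_supp :: "('k::field, 'n::finite) padic_datum \<Rightarrow> ('k, 'n) sqmat set \<Rightarrow>
    (('k, 'n) sqmat \<Rightarrow> 'r::comm_ring_1) set" where
  "hecke_supp D X = {f\<in>hecke D. \<forall>g. f g \<noteq> 0 \<longrightarrow> g \<in> X}"

text \<open>Integral of a locally constant compactly supported function; such a function takes only
  finitely many values.\<close>

definition haar_integral :: "('k::field, 'n::finite) padic_datum \<Rightarrow> (('k, 'n) sqmat set \<Rightarrow> rat) \<Rightarrow>
    (('k, 'n) sqmat \<Rightarrow> 'r::comm_ring_1) \<Rightarrow> 'r" where
  "haar_integral D \<mu> f =
     (\<Sum>r\<in>f ` G_set D - {0}. r * of_Zp_inv (residue_char D) (\<mu> {g\<in>G_set D. f g = r}))"

definition convol :: "('k::field, 'n::finite) padic_datum \<Rightarrow> (('k, 'n) sqmat set \<Rightarrow> rat) \<Rightarrow>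
    (('k, 'n) sqmat \<Rightarrow> 'r::comm_ring_1) \<Rightarrow> (('k, 'n) sqmat \<Rightarrow> 'r) \<Rightarrow> ('k, 'n) sqmat \<Rightarrow> 'r" where
  "convol D \<mu> f h = (\<lambda>x. if x \<in> G_set D
     then haar_integral D \<mu> (\<lambda>y. if y \<in> G_set D then f y * h (matrix_inv y ** x) else 0) else 0)"

definition is_smooth_char ::
    "('k::field, 'n::finite) padic_datum \<Rightarrow> (('k, 'n) sqmat \<Rightarrow> 'r::comm_ring_1) \<Rightarrow> bool" where
  "is_smooth_char D \<omega> \<longleftrightarrow> \<omega> (mat 1) = 1 \<and>
     (\<forall>g\<in>G_set D. \<forall>h\<in>G_set D. \<omega> (g ** h) = \<omega> g * \<omega> h) \<and>
     openin (G_top D) {g\<in>G_set D. \<omega> g = 1}"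

text \<open>For \<open>x\<close> in \<open>X\<close>, the inverse of \<open>\<omega>(X)\<close> is \<open>\<omega>(x\<^sup>-\<^sup>1)\<close>.\<close>

definition commutator_span :: "('k::field, 'n::finite) padic_datum \<Rightarrow> (('k, 'n) sqmat set \<Rightarrow> rat) \<Rightarrow>
    (('k, 'n) sqmat \<Rightarrow> 'r::comm_ring_1) \<Rightarrow> (('k, 'n) sqmat \<Rightarrow> 'r) set" where
  "commutator_span D \<mu> \<omega> = module.span (\<lambda>c f g. c * f g)
     {(\<lambda>g. convol D \<mu> (indicator X) (indicator X') g -
           \<omega> (matrix_inv x) * convol D \<mu> (indicator X') (indicator (twist D ` X)) g) |X X' x.
        open_compact D X \<and> open_compact D X' \<and> x \<in> X \<and> (\<forall>y\<in>X. \<omega> y = \<omega> x)}"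

definition hecke_add :: "('k::field, 'n::finite) padic_datum \<Rightarrow> (('k, 'n) sqmat \<Rightarrow> 'r::comm_ring_1) monoid" where
  "hecke_add D = \<lparr>carrier = hecke D, monoid.mult = (+), one = 0\<rparr>"

definition cocenter :: "('k::field, 'n::finite) padic_datum \<Rightarrow> (('k, 'n) sqmat set \<Rightarrow> rat) \<Rightarrow>
    (('k, 'n) sqmat \<Rightarrow> 'r::comm_ring_1) \<Rightarrow> (('k, 'n) sqmat \<Rightarrow> 'r) set monoid" where
  "cocenter D \<mu> \<omega> = hecke_add D Mod commutator_span D \<mu> \<omega>"

text \<open>The image in the cocenter of the submodule of functions supported in \<open>X\<close>.\<close>

definition cocenter_supp :: "('k::field, 'n::finite) padic_datum \<Rightarrow> (('k, 'n) sqmat set \<Rightarrow> rat) \<Rightarrow>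
    (('k, 'n) sqmat \<Rightarrow> 'r::comm_ring_1) \<Rightarrow> ('k, 'n) sqmat set \<Rightarrow> (('k, 'n) sqmat \<Rightarrow> 'r) set set" where
  "cocenter_supp D \<mu> \<omega> X = (\<lambda>f. commutator_span D \<mu> \<omega> #>\<^bsub>hecke_add D\<^esub> f) ` hecke_supp D X"

text \<open>The sum of a family of submodules; being closed under scalars, they have the subgroup
  generated by their union as their sum.\<close>

definition cocenter_sum :: "('k::field, 'n::finite) padic_datum \<Rightarrow> (('k, 'n) sqmat set \<Rightarrow> rat) \<Rightarrow>
    (('k, 'n) sqmat \<Rightarrow> 'r::comm_ring_1) \<Rightarrow> 'i set \<Rightarrow>
    ('i \<Rightarrow> (('k, 'n) sqmat \<Rightarrow> 'r) set set) \<Rightarrow> (('k, 'n) sqmat \<Rightarrow> 'r) set set" where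
  "cocenter_sum D \<mu> \<omega> I M = generate (cocenter D \<mu> \<omega>) (\<Union>i\<in>I. M i)"

end

theory Submission
  imports Defs
begin

text \<open>
  One inclusion is formal: for \<open>w\<close> of minimal length with \<open>\<pi>(w) = \<nu>\<close>, the double coset of \<open>w\<close> lies in
  the stratum \<open>G(\<nu>)\<close>, and the functions supported in \<open>G(\<nu>)\<close> form a submodule.

  For the other inclusion let \<open>f\<close> be a locally constant function with compact support in \<open>G(\<nu>)\<close>.  A
  point of the support has the form \<open>x u \<theta>(x)\<inverse>\<close> with \<open>x \<in> G\<close> and \<open>u\<close> in the double coset \<open>I w I\<close> of some
  such \<open>w\<close>.  This double coset is open, because the Iwahori subgroup \<open>I\<close> is a finite union of
  translates of the open subgroup \<open>P\<close>.  Hence \<open>h \<mapsto> x\<inverse> h \<theta>(x)\<close> carries a whole neighbourhood of the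
  point into \<open>I w I\<close> (\<open>newton_stratum_neighbourhood\<close>).  By compactness \<open>f\<close> is a finite linear combination
  of characteristic functions of cosets \<open>s K\<close> of one open subgroup \<open>K\<close>, each of them contained in such a
  neighbourhood (\<open>hecke_coset_expansion\<close>).  It remains to see that the class of the characteristic
  function of \<open>s K\<close> in the cocenter is a multiple of that of \<open>x\<inverse> s K \<theta>(x)\<close>, which is supported
  in \<open>I w I\<close>.

  With \<open>Y = x\<inverse> s K\<close> this is the congruence \<open>\<one>\<^bsub>xY\<^esub> \<equiv> \<omega>(x)\<inverse> \<one>\<^bsub>Y\<theta>(x)\<^esub>\<close> modulo twisted commutators
  (\<open>twisted_translate_mod_N\<close>).  Take an open subgroup \<open>M\<close> of \<open>P\<close> so small that \<open>\<omega>\<close> is trivial on it,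
  that \<open>M Y = Y\<close>, and that \<open>Y\<close> is stable under right multiplication by \<open>\<theta>(x M x\<inverse>)\<close>.  Then the
  convolutions of \<open>\<one>\<^bsub>xM\<^esub>\<close> with \<open>\<one>\<^bsub>Y\<^esub>\<close> and of \<open>\<one>\<^bsub>Y\<^esub>\<close> with \<open>\<one>\<^bsub>\<theta>(xM)\<^esub>\<close> are \<open>\<mu>(M) \<one>\<^bsub>xY\<^esub>\<close> and
  \<open>\<mu>(\<theta>(M)) \<one>\<^bsub>Y\<theta>(x)\<^esub>\<close>.  The two volumes agree, because \<open>\<theta>\<close> preserves \<open>I\<close> and so \<open>M\<close> and \<open>\<theta>(M)\<close> have
  the same index in \<open>I\<close> (\<open>mu_theta\<close>).  The common volume is the inverse of a power of \<open>p\<close>, because \<open>P\<close>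
  is a pro-\<open>p\<close> group (\<open>mu_small\<close>); it is therefore a unit of the coefficient ring and can be cancelled.

  The topological input is that \<open>G\<close> has arbitrarily small open subgroups.  These are the congruence
  subgroups; Cramer's rule shows that they are closed under inversion (\<open>small_open_subgroup\<close>).
\<close>

section \<open>Fractional ideals and integral matrices\<close>

locale nonarch_field =
  fixes p :: nat and F :: "'k::field set" and val :: "'k \<Rightarrow> int"
  assumes local_field: "local_field p F val"
begin

lemma prime_p: "prime p"
  and F_zero [simp]: "0 \<in> F" and F_one [simp]: "1 \<in> F"
  and F_diff [simp]: "x \<in> F \<Longrightarrow> y \<in> F \<Longrightarrow> x - y \<in> F"
  and F_mult [simp]: "x \<in> F \<Longrightarrow> y \<in> F \<Longrightarrow> x * y \<in> F"
  and F_inverse [simp]: "x \<in> F \<Longrightarrow> inverse x \<in> F"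
  and val_mult: "x \<in> F \<Longrightarrow> y \<in> F \<Longrightarrow> x \<noteq> 0 \<Longrightarrow> y \<noteq> 0 \<Longrightarrow> val (x * y) = val x + val y"
  and val_add: "x \<in> F \<Longrightarrow> y \<in> F \<Longrightarrow> x \<noteq> 0 \<Longrightarrow> y \<noteq> 0 \<Longrightarrow> x + y \<noteq> 0
    \<Longrightarrow> min (val x) (val y) \<le> val (x + y)"
  using local_field by (auto simp: local_field_def is_subfield_def)

lemma F_uminus [simp]: "x \<in> F \<Longrightarrow> - x \<in> F"
  using F_diff[of 0 x] by simp

lemma F_add [simp]: "x \<in> F \<Longrightarrow> y \<in> F \<Longrightarrow> x + y \<in> F"
  using F_diff[of x "- y"] by simp

lemma F_sum [simp]: "(\<And>i. i \<in> A \<Longrightarrow> f i \<in> F) \<Longrightarrow> sum f A \<in> F"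
  by (induction A rule: infinite_finite_induct) auto

lemma F_prod [simp]: "(\<And>i. i \<in> A \<Longrightarrow> f i \<in> F) \<Longrightarrow> prod f A \<in> F"
  by (induction A rule: infinite_finite_induct) auto

lemma F_sign [simp]: "of_int (sign q) \<in> F"
  by (cases rule: sign_cases[of q]) auto

lemma val_one [simp]: "val 1 = 0"
  using val_mult[of 1 1] by simp

lemma val_uminus [simp]:
  assumes "x \<in> F" shows "val (- x) = val x"
proof (cases "x = 0")
  case False
  have "val (- 1) + val (- 1) = 0"
    using val_mult[of "- 1" "- 1"] by simp
  then show ?thesis
    using val_mult[of "- 1" x] assms False by simp
qed auto

lemma val_inverse: "x \<in> F \<Longrightarrow> x \<noteq> 0 \<Longrightarrow> val (inverse x) = - val x"
  using val_mult[of x "inverse x"] by simp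

definition frac_ideal :: "int \<Rightarrow> 'k set" where
  "frac_ideal m = {x \<in> F. x = 0 \<or> m \<le> val x}"

lemma near_iff: "x \<in> F \<Longrightarrow> y \<in> F \<Longrightarrow> near val m x y \<longleftrightarrow> x - y \<in> frac_ideal m"
  by (auto simp: near_def frac_ideal_def)

lemma frac_ideal_F: "x \<in> frac_ideal m \<Longrightarrow> x \<in> F"
  by (simp add: frac_ideal_def)

lemma frac_ideal_zero [simp]: "0 \<in> frac_ideal m"
  by (simp add: frac_ideal_def)

lemma frac_ideal_mono: "m \<le> n \<Longrightarrow> x \<in> frac_ideal n \<Longrightarrow> x \<in> frac_ideal m"
  by (auto simp: frac_ideal_def)

lemma frac_ideal_uminus: "x \<in> frac_ideal m \<Longrightarrow> - x \<in> frac_ideal m"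
  by (auto simp: frac_ideal_def)

lemma frac_ideal_add: "x \<in> frac_ideal m \<Longrightarrow> y \<in> frac_ideal m \<Longrightarrow> x + y \<in> frac_ideal m"
  using val_add[of x y] by (force simp: frac_ideal_def)

lemma frac_ideal_diff: "x \<in> frac_ideal m \<Longrightarrow> y \<in> frac_ideal m \<Longrightarrow> x - y \<in> frac_ideal m"
  using frac_ideal_add[of x m "- y"] frac_ideal_uminus[of y m] by simp

lemma frac_ideal_mult: "x \<in> frac_ideal m \<Longrightarrow> y \<in> frac_ideal n \<Longrightarrow> x * y \<in> frac_ideal (m + n)"
  using val_mult[of x y] by (fastforce simp: frac_ideal_def)

lemma frac_ideal_sum: "(\<And>i. i \<in> A \<Longrightarrow> f i \<in> frac_ideal m) \<Longrightarrow> sum f A \<in> frac_ideal m"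
  by (induction A rule: infinite_finite_induct) (auto intro: frac_ideal_add)

lemma one_integral: "1 \<in> frac_ideal 0"
  by (simp add: frac_ideal_def)

lemma integral_prod: "(\<And>i. i \<in> A \<Longrightarrow> f i \<in> frac_ideal 0) \<Longrightarrow> prod f A \<in> frac_ideal 0"
proof (induction A rule: infinite_finite_induct)
  case (insert a A)
  then show ?case using frac_ideal_mult[of "f a" 0 "prod f A" 0] by auto
qed (auto simp: one_integral)

text \<open>Induction on the index set, one factor at a time:
  \<open>f a * A - h a * B = f a * (A - B) + (f a - h a) * B\<close>.\<close>

lemma integral_prod_cong:
  assumes "\<And>i. i \<in> A \<Longrightarrow> f i \<in> frac_ideal 0" "\<And>i. i \<in> A \<Longrightarrow> h i \<in> frac_ideal 0"
    and "\<And>i. i \<in> A \<Longrightarrow> f i - h i \<in> frac_ideal m"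
  shows "prod f A - prod h A \<in> frac_ideal m"
  using assms
proof (induction A rule: infinite_finite_induct)
  case (insert a A)
  have "f a * (prod f A - prod h A) \<in> frac_ideal (0 + m)"
    using insert by (intro frac_ideal_mult) auto
  moreover have "(f a - h a) * prod h A \<in> frac_ideal (m + 0)"
    using insert by (intro frac_ideal_mult integral_prod) auto
  ultimately have "f a * (prod f A - prod h A) + (f a - h a) * prod h A \<in> frac_ideal m"
    by (intro frac_ideal_add) auto
  then show ?case
    using insert by (simp add: algebra_simps)
qed auto

text \<open>If \<open>x\<close> had positive valuation, then so would \<open>1 = x - (x - 1)\<close>.  Hence \<open>x\<close> has
  valuation \<open>0\<close>, and so does its inverse.\<close>

lemma principal_unit:
  assumes "x - 1 \<in> frac_ideal m" "1 \<le> m"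
  shows "x \<noteq> 0" "inverse x \<in> frac_ideal 0"
proof -
  have x1: "x - 1 \<in> frac_ideal 1"
    using assms frac_ideal_mono by blast
  have not1: "x \<notin> frac_ideal 1"
  proof
    assume "x \<in> frac_ideal 1"
    then have "x - (x - 1) \<in> frac_ideal 1" using x1 frac_ideal_diff by blast
    then show False by (simp add: frac_ideal_def)
  qed
  then show "x \<noteq> 0" by auto
  have F: "x \<in> F"
    using F_add[OF frac_ideal_F[OF x1] F_one] by simp
  then have "val x \<le> 0"
    using not1 by (auto simp: frac_ideal_def)
  moreover have "x \<in> frac_ideal 0"
    using frac_ideal_add[OF frac_ideal_mono[OF _ x1, of 0] one_integral] by simp
  ultimately show "inverse x \<in> frac_ideal 0"
    using F \<open>x \<noteq> 0\<close> val_inverse by (auto simp: frac_ideal_def)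
qed

definition mat_ideal :: "int \<Rightarrow> ('k, 'n::finite) sqmat set" where
  "mat_ideal m = {A. \<forall>i j. A $ i $ j \<in> frac_ideal m}"

definition mat_F :: "('k, 'n::finite) sqmat set" where
  "mat_F = {A. \<forall>i j. A $ i $ j \<in> F}"

lemma mat_ideal_mono: "m \<le> n \<Longrightarrow> A \<in> mat_ideal n \<Longrightarrow> A \<in> mat_ideal m"
  by (auto simp: mat_ideal_def intro: frac_ideal_mono)

lemma mat_ideal_zero [simp]: "0 \<in> mat_ideal m"
  by (simp add: mat_ideal_def)

lemma mat_ideal_add: "A \<in> mat_ideal m \<Longrightarrow> B \<in> mat_ideal m \<Longrightarrow> A + B \<in> mat_ideal m"
  by (auto simp: mat_ideal_def intro: frac_ideal_add)

lemma mat_ideal_uminus: "A \<in> mat_ideal m \<Longrightarrow> - A \<in> mat_ideal m"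
  by (auto simp: mat_ideal_def intro: frac_ideal_uminus)

lemma mat_ideal_mult: "A \<in> mat_ideal m \<Longrightarrow> B \<in> mat_ideal n \<Longrightarrow> A ** B \<in> mat_ideal (m + n)"
  by (auto simp: mat_ideal_def matrix_matrix_mult_def intro!: frac_ideal_sum frac_ideal_mult)

lemma mat_one_integral: "mat 1 \<in> mat_ideal 0"
  by (simp add: mat_ideal_def mat_def one_integral)

lemma mat_F_one: "mat 1 \<in> mat_F"
  by (simp add: mat_F_def mat_def)

lemma mat_F_mult: "A \<in> mat_F \<Longrightarrow> B \<in> mat_F \<Longrightarrow> A ** B \<in> mat_F"
  by (auto simp: mat_F_def matrix_matrix_mult_def)

lemma mat_F_bounded:
  assumes "A \<in> mat_F" shows "\<exists>c. A \<in> mat_ideal c"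
proof -
  define S where "S = (\<lambda>(i, j). val (A $ i $ j)) ` UNIV"
  have "finite S" by (simp add: S_def)
  then have "Min S \<le> val (A $ i $ j)" for i j
    by (intro Min_le) (auto simp: S_def)
  then have "A \<in> mat_ideal (Min S)"
    using assms by (auto simp: mat_ideal_def mat_F_def frac_ideal_def)
  then show ?thesis ..
qed

lemma det_F: "A \<in> mat_F \<Longrightarrow> det A \<in> F"
  by (auto simp: det_def mat_F_def intro!: F_sum F_mult F_prod)

lemma frac_ideal_sign:
  assumes "x \<in> frac_ideal m" shows "of_int (sign q) * x \<in> frac_ideal m"
  by (cases rule: sign_cases[of q]) (use assms in \<open>auto intro: frac_ideal_uminus\<close>)

lemma det_integral: "A \<in> mat_ideal 0 \<Longrightarrow> det A \<in> frac_ideal 0"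
  by (auto simp: det_def mat_ideal_def intro!: frac_ideal_sum frac_ideal_sign integral_prod)

text \<open>The determinant is a polynomial with integer coefficients in the entries, so that it respects
  congruences between integral matrices.\<close>

lemma det_principal_unit:
  fixes A :: "('k, 'n::finite) sqmat"
  assumes "A - mat 1 \<in> mat_ideal m" "0 \<le> m"
  shows "det A - 1 \<in> frac_ideal m"
proof -
  have A: "A \<in> mat_ideal 0"
    using mat_ideal_add[OF mat_ideal_mono[OF assms(2,1)] mat_one_integral] by simp
  have "det A - det (mat 1 :: ('k, 'n) sqmat) = (\<Sum>q | q permutes UNIV.
      of_int (sign q) * ((\<Prod>i\<in>UNIV. A $ i $ q i) - (\<Prod>i\<in>UNIV. (mat 1 :: ('k, 'n) sqmat) $ i $ q i)))"
    by (simp only: det_def right_diff_distrib sum_subtractf)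
  also have "\<dots> \<in> frac_ideal m"
    using A mat_one_integral assms
    by (intro frac_ideal_sum frac_ideal_sign integral_prod_cong) (auto simp: mat_ideal_def)
  finally show ?thesis by simp
qed

lemma matrix_matrix_mult_diff:
  fixes A B C :: "('k, 'n::finite) sqmat"
  shows "A ** (B - C) = A ** B - A ** C" "(B - C) ** A = B ** A - C ** A"
  by (simp_all add: vec_eq_iff matrix_matrix_mult_def algebra_simps sum_subtractf)

lemma matrix_inv_inverse:
  fixes A :: "('k, 'n::finite) sqmat"
  assumes "det A \<noteq> 0"
  shows "A ** matrix_inv A = mat 1" "matrix_inv A ** A = mat 1"
proof -
  have "\<exists>B. A ** B = mat 1 \<and> B ** A = mat 1"
    using assms by (simp add: invertible_det_nz[symmetric] invertible_def)
  then have "A ** matrix_inv A = mat 1 \<and> matrix_inv A ** A = mat 1"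
    unfolding matrix_inv_def by (rule someI_ex)
  then show "A ** matrix_inv A = mat 1" "matrix_inv A ** A = mat 1" by auto
qed

text \<open>By Cramer's rule the entries of the inverse are, up to division by the determinant, again
  determinants.  This is what shows that inversion preserves the field of the entries
  (\<open>matrix_inv_F\<close>) and their integrality (\<open>matrix_inv_principal_unit\<close>).\<close>

lemma matrix_inv_cramer:
  fixes A :: "('k, 'n::finite) sqmat"
  assumes "det A \<noteq> 0"
  shows "matrix_inv A $ k $ l = det (\<chi> i j. if j = k then axis l 1 $ i else A $ i $ j) / det A"
proof -
  have "A *v (matrix_inv A *v axis l 1) = axis l 1"
    using matrix_inv_inverse[OF assms] by (simp add: matrix_vector_mul_assoc)
  then have "matrix_inv A *v axis l 1 =
      (\<chi> k. det (\<chi> i j. if j = k then axis l 1 $ i else A $ i $ j) / det A)"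
    using cramer[OF assms] by blast
  moreover have "(matrix_inv A *v axis l 1) $ k = matrix_inv A $ k $ l"
    by (simp add: matrix_vector_mult_def axis_def if_distrib cong: if_cong)
  ultimately show ?thesis by simp
qed

lemma matrix_inv_F:
  fixes A :: "('k, 'n::finite) sqmat"
  assumes "A \<in> mat_F" "det A \<noteq> 0" shows "matrix_inv A \<in> mat_F"
proof -
  have "det (\<chi> i j. if j = k then axis l 1 $ i else A $ i $ j) \<in> F" for k l
    using assms(1) by (intro det_F) (auto simp: mat_F_def axis_def)
  then show ?thesis
    using F_mult F_inverse det_F[OF assms(1)]
    by (auto simp: mat_F_def matrix_inv_cramer[OF assms(2)] divide_inverse)
qed

text \<open>The inverse of \<open>A\<close> is integral by Cramer's rule, and \<open>A\<inverse> - 1 = - A\<inverse> (A - 1)\<close>.\<close>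

lemma matrix_inv_principal_unit:
  fixes A :: "('k, 'n::finite) sqmat"
  assumes "A - mat 1 \<in> mat_ideal m" "1 \<le> m"
  shows "det A \<noteq> 0" "matrix_inv A - mat 1 \<in> mat_ideal m"
proof -
  have d: "det A - 1 \<in> frac_ideal m"
    using assms det_principal_unit by force
  show nz: "det A \<noteq> 0"
    using principal_unit(1)[OF d assms(2)] .
  have A: "A \<in> mat_ideal 0"
    using mat_ideal_add[OF mat_ideal_mono[OF _ assms(1), of 0] mat_one_integral] assms(2) by simp
  have "det (\<chi> i j. if j = k then axis l 1 $ i else A $ i $ j) \<in> frac_ideal 0" for k l
    using A one_integral by (intro det_integral) (auto simp: mat_ideal_def axis_def)
  from frac_ideal_mult[OF this principal_unit(2)[OF d assms(2)]]
  have "matrix_inv A \<in> mat_ideal 0"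
    by (auto simp: mat_ideal_def matrix_inv_cramer[OF nz] divide_inverse)
  then have "matrix_inv A ** - (A - mat 1) \<in> mat_ideal (0 + m)"
    using assms(1) by (intro mat_ideal_mult mat_ideal_uminus)
  moreover have "matrix_inv A ** - (A - mat 1) = matrix_inv A - mat 1"
    using matrix_inv_inverse[OF nz]
    by (simp add: matrix_matrix_mult_diff)
  ultimately show "matrix_inv A - mat 1 \<in> mat_ideal m" by simp
qed

end


section \<open>The topological group\<close>

lemma group_GLn: "group (GLn :: ('k::field, 'n::finite) sqmat monoid)"
proof (rule groupI)
  show "\<one>\<^bsub>GLn\<^esub> \<in> carrier (GLn :: ('k, 'n) sqmat monoid)"
    by (simp add: GLn_def)
next
  fix x :: "('k, 'n) sqmat" assume "x \<in> carrier GLn"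
  then have "det x \<noteq> 0" by (simp add: GLn_def)
  then obtain y where y: "y ** x = mat 1" "x ** y = mat 1"
    unfolding invertible_det_nz[symmetric] invertible_def by blast
  have "det (y ** x) = 1" by (simp add: y)
  then have "det y \<noteq> 0" by (auto simp: det_mul)
  then show "\<exists>y\<in>carrier GLn. y \<otimes>\<^bsub>GLn\<^esub> x = \<one>\<^bsub>GLn\<^esub>"
    using y by (auto simp: GLn_def)
qed (auto simp: GLn_def det_mul matrix_mul_assoc)

lemma sum_pointwise: "(\<Sum>a\<in>A. f a) x = (\<Sum>a\<in>A. f a x)" for f :: "'a \<Rightarrow> 'b \<Rightarrow> 'c::comm_monoid_add"
  by (induction A rule: infinite_finite_induct) auto

lemma module_functions: "module (\<lambda>(c::'r::comm_ring_1) (f :: 'a \<Rightarrow> 'r) g. c * f g)"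
  by unfold_locales (simp_all add: fun_eq_iff algebra_simps)

locale padic_group =
  fixes D :: "('k::alg_closed_field, 'n::finite) padic_datum"
  assumes datum: "is_padic_datum D"
begin

sublocale nonarch_field "residue_char D" "base_field D" "valuation D"
  using datum by unfold_locales (simp add: is_padic_datum_def)

abbreviation G where "G \<equiv> G_set D"
abbreviation T where "T \<equiv> G_top D"

lemma subgroup_alg_grp: "subgroup (alg_grp D) GLn"
  using datum by (simp add: is_padic_datum_def reductive_def alg_group_def)

lemma G_iff: "g \<in> G \<longleftrightarrow> g \<in> alg_grp D \<and> g \<in> mat_F"
  by (auto simp: G_set_def points_def mat_F_def)

lemma G_det: "g \<in> G \<Longrightarrow> det g \<noteq> 0"
  using subgroup.subset[OF subgroup_alg_grp] by (auto simp: G_iff GLn_def)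

lemma inv_GLn: "det g \<noteq> 0 \<Longrightarrow> inv\<^bsub>GLn\<^esub> g = matrix_inv (g :: ('k, 'n) sqmat)"
proof -
  assume d: "det g \<noteq> 0"
  have "det (matrix_inv g ** g) = 1" using matrix_inv_inverse[OF d] by simp
  then have "det (matrix_inv g) \<noteq> 0" by (auto simp: det_mul)
  then show ?thesis
    using d matrix_inv_inverse[OF d]
    by (intro group.inv_equality[OF group_GLn]) (auto simp: GLn_def)
qed

lemma G_one [simp]: "mat 1 \<in> G"
  using subgroup.one_closed[OF subgroup_alg_grp] mat_F_one by (auto simp: G_iff GLn_def)

lemma G_mult [simp]: "g \<in> G \<Longrightarrow> h \<in> G \<Longrightarrow> g ** h \<in> G"
  using subgroup.m_closed[OF subgroup_alg_grp] mat_F_mult by (auto simp: G_iff GLn_def)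

lemma G_inv [simp]: "g \<in> G \<Longrightarrow> matrix_inv g \<in> G"
  using subgroup.m_inv_closed[OF subgroup_alg_grp] matrix_inv_F G_det inv_GLn
  by (metis G_iff)

lemma inv_l [simp]: "g \<in> G \<Longrightarrow> matrix_inv g ** g = mat 1"
  and inv_r [simp]: "g \<in> G \<Longrightarrow> g ** matrix_inv g = mat 1"
  using matrix_inv_inverse G_det by auto

lemma inv_l' [simp]: "g \<in> G \<Longrightarrow> matrix_inv g ** (g ** h) = h"
  and inv_r' [simp]: "g \<in> G \<Longrightarrow> g ** (matrix_inv g ** h) = h"
  by (simp_all add: matrix_mul_assoc)

lemma inv_eqI: "g \<in> G \<Longrightarrow> h \<in> G \<Longrightarrow> g ** h = mat 1 \<Longrightarrow> matrix_inv g = h"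
  by (metis inv_l' matrix_mul_rid)

lemma inv_inv [simp]: "g \<in> G \<Longrightarrow> matrix_inv (matrix_inv g) = g"
  by (intro inv_eqI) auto

lemmas assoc = matrix_mul_assoc[symmetric]

lemma inv_mult [simp]: "g \<in> G \<Longrightarrow> h \<in> G \<Longrightarrow> matrix_inv (g ** h) = matrix_inv h ** matrix_inv g"
  by (intro inv_eqI) (auto simp: assoc)

lemma inv_one [simp]: "matrix_inv (mat 1 :: ('k, 'n) sqmat) = mat 1"
  by (intro inv_eqI) auto

lemma G_group_simps [simp]:
  "carrier (G_group D) = G" "\<one>\<^bsub>G_group D\<^esub> = mat 1" "x \<otimes>\<^bsub>G_group D\<^esub> y = x ** y"
  by (simp_all add: G_group_def GLn_def)

lemma subgroup_G: "subgroup G GLn"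
proof
  show "G \<subseteq> carrier GLn" using G_det by (auto simp: GLn_def)
  show "inv\<^bsub>GLn\<^esub> x \<in> G" if "x \<in> G" for x
    using that G_det inv_GLn by simp
qed (simp_all add: GLn_def)

lemma group_G: "group (G_group D)"
  unfolding G_group_def by (rule subgroup.subgroup_is_group[OF subgroup_G group_GLn])

lemma inv_G_group [simp]: "g \<in> G \<Longrightarrow> inv\<^bsub>G_group D\<^esub> g = matrix_inv g"
  by (intro group.inv_equality[OF group_G]) auto

lemma subgroup_G_group_iff:
  "subgroup K (G_group D) \<longleftrightarrow> K \<subseteq> G \<and> mat 1 \<in> K \<and> (\<forall>x\<in>K. \<forall>y\<in>K. x ** y \<in> K) \<and>
     (\<forall>x\<in>K. matrix_inv x \<in> K)"
  (is "?L = ?R")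
proof
  assume L: ?L
  show ?R
    using subgroup.subset[OF L] subgroup.one_closed[OF L] subgroup.m_closed[OF L]
      subgroup.m_inv_closed[OF L] by (auto simp: subset_iff)
next
  assume ?R
  then show ?L by (intro group.subgroupI[OF group_G]) (auto simp: subset_iff)
qed

lemma near_entries_iff:
  assumes "g \<in> G" "h \<in> G"
  shows "(\<forall>i j. near (valuation D) m (h $ i $ j) (g $ i $ j)) \<longleftrightarrow> h - g \<in> mat_ideal m"
  using assms by (simp add: near_iff G_iff mat_F_def mat_ideal_def)

lemma openin_G: "openin T U \<longleftrightarrow> U \<subseteq> G \<and> (\<forall>g\<in>U. \<exists>m. \<forall>h\<in>G. h - g \<in> mat_ideal m \<longrightarrow> h \<in> U)"
proof -
  let ?near = "\<lambda>U g m. \<forall>h\<in>G. (\<forall>i j. near (valuation D) m (h $ i $ j) (g $ i $ j)) \<longrightarrow> h \<in> U"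
  let ?open = "\<lambda>U. U \<subseteq> G \<and> (\<forall>g\<in>U. \<exists>m. ?near U g m)"
  have mono: "?near U g n" if "?near U g m" "m \<le> n" for U g m n
    using that by (fastforce simp: near_def)
  have Int: "\<exists>m. ?near (U1 \<inter> U2) g m" if "?near U1 g m1" "?near U2 g m2" for U1 U2 g m1 m2
    by (rule exI[of _ "max m1 m2"])
      (use mono[OF that(1), of "max m1 m2"] mono[OF that(2), of "max m1 m2"] in simp)
  have "istopology ?open"
    unfolding istopology_def
  proof (intro conjI allI impI)
    fix S1 S2 assume S: "?open S1" "?open S2"
    then show "S1 \<inter> S2 \<subseteq> G" by blast
    show "\<forall>g\<in>S1 \<inter> S2. \<exists>m. ?near (S1 \<inter> S2) g m"
    proof
      fix g assume "g \<in> S1 \<inter> S2"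
      then obtain m1 m2 where "?near S1 g m1" "?near S2 g m2"
        using S by blast
      then show "\<exists>m. ?near (S1 \<inter> S2) g m" by (rule Int)
    qed
  next
    fix \<K> assume K: "\<forall>U\<in>\<K>. ?open U"
    then show "\<Union>\<K> \<subseteq> G" by blast
    show "\<forall>g\<in>\<Union>\<K>. \<exists>m. ?near (\<Union>\<K>) g m"
    proof
      fix g assume "g \<in> \<Union>\<K>"
      then obtain U where U: "U \<in> \<K>" "g \<in> U" by blast
      then obtain m where "?near U g m" using K by blast
      then show "\<exists>m. ?near (\<Union>\<K>) g m" using U by blast
    qed
  qed
  then have open_iff: "openin T U \<longleftrightarrow> ?open U"
    unfolding G_top_def by (simp add: topology_inverse')
  have "?near U g m \<longleftrightarrow> (\<forall>h\<in>G. h - g \<in> mat_ideal m \<longrightarrow> h \<in> U)" if "g \<in> G" for g m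
    using near_entries_iff[OF that] by blast
  then show ?thesis
    unfolding open_iff by (meson subsetD)
qed

lemma openin_G_near:
  assumes "openin T U" "g \<in> U"
  obtains m where "\<And>h. h \<in> G \<Longrightarrow> h - g \<in> mat_ideal m \<Longrightarrow> h \<in> U"
  using assms openin_G[of U] by metis

lemma openin_G_subset: "openin T U \<Longrightarrow> g \<in> U \<Longrightarrow> g \<in> G"
  using openin_G[of U] by auto

lemma topspace_G [simp]: "topspace T = G"
proof
  show "topspace T \<subseteq> G" using openin_G_subset by auto
  have "openin T G" by (auto simp: openin_G)
  then show "G \<subseteq> topspace T" by (rule openin_subset)
qed

text \<open>The entries of \<open>g\<inverse>\<close> lie in a fixed fractional ideal, so multiplication by \<open>g\<inverse>\<close> weakens a
  congruence by a bounded amount only.  This bounds the neighbourhoods needed in a translate.\<close>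

lemma openin_translate_left:
  assumes "openin T U" "g \<in> G"
  shows "openin T ((**) g ` U)"
  unfolding openin_G
proof (intro conjI ballI)
  show "(**) g ` U \<subseteq> G" using assms openin_G_subset by auto
next
  fix x assume "x \<in> (**) g ` U"
  then obtain u where u: "u \<in> U" "x = g ** u" by blast
  obtain m where m: "\<And>h. h \<in> G \<Longrightarrow> h - u \<in> mat_ideal m \<Longrightarrow> h \<in> U"
    using openin_G_near[OF assms(1) u(1)] by blast
  obtain c where c: "matrix_inv g \<in> mat_ideal c"
    using mat_F_bounded[of "matrix_inv g"] G_inv[OF assms(2)] by (auto simp: G_iff)
  have "h \<in> (**) g ` U" if h: "h \<in> G" "h - x \<in> mat_ideal (m - c)" for h
  proof -
    have "matrix_inv g ** (h - x) \<in> mat_ideal m"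
      using mat_ideal_mult[OF c h(2)] by simp
    then have "matrix_inv g ** h - u \<in> mat_ideal m"
      by (simp add: matrix_matrix_mult_diff u assms(2))
    then have "matrix_inv g ** h \<in> U" using m h assms(2) by simp
    then show ?thesis using assms(2) by (intro image_eqI[of _ _ "matrix_inv g ** h"]) auto
  qed
  then show "\<exists>m. \<forall>h\<in>G. h - x \<in> mat_ideal m \<longrightarrow> h \<in> (**) g ` U" by blast
qed

lemma openin_translate_right:
  assumes "openin T U" "g \<in> G"
  shows "openin T ((\<lambda>x. x ** g) ` U)"
  unfolding openin_G
proof (intro conjI ballI)
  show "(\<lambda>x. x ** g) ` U \<subseteq> G" using assms openin_G_subset by auto
next
  fix x assume "x \<in> (\<lambda>x. x ** g) ` U"
  then obtain u where u: "u \<in> U" "x = u ** g" by blast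
  obtain m where m: "\<And>h. h \<in> G \<Longrightarrow> h - u \<in> mat_ideal m \<Longrightarrow> h \<in> U"
    using openin_G_near[OF assms(1) u(1)] by blast
  obtain c where c: "matrix_inv g \<in> mat_ideal c"
    using mat_F_bounded[of "matrix_inv g"] G_inv[OF assms(2)] by (auto simp: G_iff)
  have "h \<in> (\<lambda>x. x ** g) ` U" if h: "h \<in> G" "h - x \<in> mat_ideal (m - c)" for h
  proof -
    have "(h - x) ** matrix_inv g \<in> mat_ideal m"
      using mat_ideal_mult[OF h(2) c] by simp
    then have "h ** matrix_inv g - u \<in> mat_ideal m"
      by (simp add: matrix_matrix_mult_diff u assms(2) assoc)
    then have "h ** matrix_inv g \<in> U" using m h assms(2) by simp
    then show ?thesis
      using assms(2) by (intro image_eqI[of _ _ "h ** matrix_inv g"]) (auto simp: assoc)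
  qed
  then show "\<exists>m. \<forall>h\<in>G. h - x \<in> mat_ideal m \<longrightarrow> h \<in> (\<lambda>x. x ** g) ` U" by blast
qed

lemma continuous_translate_left:
  assumes "g \<in> G" shows "continuous_map T T ((**) g)"
  unfolding continuous_map
proof (intro conjI allI impI)
  show "(**) g ` topspace T \<subseteq> topspace T" using assms by auto
  fix U assume U: "openin T U"
  have "{x \<in> topspace T. g ** x \<in> U} = (**) (matrix_inv g) ` U"
  proof (intro equalityI subsetI)
    fix x assume "x \<in> {x \<in> topspace T. g ** x \<in> U}"
    then show "x \<in> (**) (matrix_inv g) ` U"
      using assms by (intro image_eqI[of _ _ "g ** x"]) auto
  qed (use assms openin_G_subset[OF U] in auto)
  then show "openin T {x \<in> topspace T. g ** x \<in> U}"
    using openin_translate_left[OF U] assms by simp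
qed

lemma continuous_translate_right:
  assumes "g \<in> G" shows "continuous_map T T (\<lambda>x. x ** g)"
  unfolding continuous_map
proof (intro conjI allI impI)
  show "(\<lambda>x. x ** g) ` topspace T \<subseteq> topspace T" using assms by auto
  fix U assume U: "openin T U"
  have "{x \<in> topspace T. x ** g \<in> U} = (\<lambda>x. x ** matrix_inv g) ` U"
  proof (intro equalityI subsetI)
    fix x assume "x \<in> {x \<in> topspace T. x ** g \<in> U}"
    then show "x \<in> (\<lambda>x. x ** matrix_inv g) ` U"
      using assms by (intro image_eqI[of _ _ "x ** g"]) (auto simp: assoc)
  qed (use assms openin_G_subset[OF U] in \<open>auto simp: assoc\<close>)
  then show "openin T {x \<in> topspace T. x ** g \<in> U}"
    using openin_translate_right[OF U] assms by simp
qed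

lemma open_compact_translate_left: "open_compact D X \<Longrightarrow> g \<in> G \<Longrightarrow> open_compact D ((**) g ` X)"
  using image_compactin continuous_translate_left openin_translate_left
  by (fastforce simp: open_compact_def)

lemma open_compact_translate_right:
  "open_compact D X \<Longrightarrow> g \<in> G \<Longrightarrow> open_compact D ((\<lambda>x. x ** g) ` X)"
  using image_compactin[OF _ continuous_translate_right] openin_translate_right
  by (fastforce simp: open_compact_def)

definition open_subgroup :: "('k, 'n) sqmat set \<Rightarrow> bool" where
  "open_subgroup K \<longleftrightarrow> subgroup K (G_group D) \<and> openin T K"

lemma open_subgroupD:
  assumes "open_subgroup K"
  shows "openin T K" "subgroup K (G_group D)" "mat 1 \<in> K" "x \<in> K \<Longrightarrow> x \<in> G"
    "x \<in> K \<Longrightarrow> y \<in> K \<Longrightarrow> x ** y \<in> K" "x \<in> K \<Longrightarrow> matrix_inv x \<in> K"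
  using assms by (auto simp: open_subgroup_def subgroup_G_group_iff)

lemma open_subgroup_Int: "open_subgroup K \<Longrightarrow> open_subgroup L \<Longrightarrow> open_subgroup (K \<inter> L)"
  by (auto simp: open_subgroup_def subgroup_G_group_iff)

text \<open>The subgroup is the set of elements congruent to \<open>1\<close> modulo a high power of the maximal ideal.
  The exponent is taken to be positive, since \<open>matrix_inv_principal_unit\<close> applies only then.\<close>

lemma small_open_subgroup:
  assumes U: "openin T U" "mat 1 \<in> U"
  shows "\<exists>K. open_subgroup K \<and> K \<subseteq> U"
proof -
  obtain m where m: "\<And>h. h \<in> G \<Longrightarrow> h - mat 1 \<in> mat_ideal m \<Longrightarrow> h \<in> U"
    using openin_G_near[OF U] by blast
  define n where "n = max m 1"
  define K where "K = {g \<in> G. g - mat 1 \<in> mat_ideal n}"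
  have n: "1 \<le> n" "m \<le> n" by (auto simp: n_def)
  have one: "mat 1 \<in> K" by (simp add: K_def)
  have mult: "x ** y \<in> K" if xy: "x \<in> K" "y \<in> K" for x y
  proof -
    have "x \<in> mat_ideal 0"
      using mat_ideal_add[OF mat_ideal_mono[of 0 n "x - mat 1"] mat_one_integral] xy n
      by (auto simp: K_def)
    then have "x ** (y - mat 1) \<in> mat_ideal n"
      using mat_ideal_mult[of x 0 "y - mat 1" n] xy by (simp add: K_def)
    then have "x ** (y - mat 1) + (x - mat 1) \<in> mat_ideal n"
      using xy by (auto intro: mat_ideal_add simp: K_def)
    then show ?thesis
      using xy by (simp add: K_def matrix_matrix_mult_diff)
  qed
  have inv: "matrix_inv x \<in> K" if "x \<in> K" for x
    using that matrix_inv_principal_unit(2)[of x n] n by (simp add: K_def)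
  have "openin T K"
    unfolding openin_G
  proof (intro conjI ballI exI impI)
    fix g h assume "g \<in> K" "h \<in> G" "h - g \<in> mat_ideal n"
    then show "h \<in> K" using mat_ideal_add[of "h - g" n "g - mat 1"] by (simp add: K_def)
  qed (auto simp: K_def)
  moreover have "subgroup K (G_group D)"
    unfolding subgroup_G_group_iff using one mult inv by (auto simp: K_def)
  moreover have "K \<subseteq> U"
    using m n mat_ideal_mono by (auto simp: K_def)
  ultimately show ?thesis by (auto simp: open_subgroup_def)
qed

text \<open>The complement is a union of cosets, which are open.\<close>

lemma closedin_open_subgroup:
  assumes "open_subgroup K" shows "closedin T K"
proof -
  have "G - K = (\<Union>g\<in>G - K. (**) g ` K)"
  proof (intro equalityI subsetI)
    fix g assume "g \<in> G - K"
    then show "g \<in> (\<Union>g\<in>G - K. (**) g ` K)"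
      using open_subgroupD(3)[OF assms] by (intro UN_I[of g] image_eqI[of _ _ "mat 1"]) auto
  next
    fix x assume "x \<in> (\<Union>g\<in>G - K. (**) g ` K)"
    then obtain g k where gk: "g \<in> G" "g \<notin> K" "k \<in> K" "x = g ** k" by blast
    then have "k \<in> G" using open_subgroupD[OF assms] by blast
    moreover have "x \<notin> K"
    proof
      assume "x \<in> K"
      then have "x ** matrix_inv k \<in> K" using gk open_subgroupD[OF assms] by blast
      then show False using gk \<open>k \<in> G\<close> by (simp add: assoc)
    qed
    ultimately show "x \<in> G - K" using gk by simp
  qed
  moreover have "openin T (\<Union>g\<in>G - K. (**) g ` K)"
    using openin_translate_left open_subgroupD[OF assms] by auto
  ultimately show ?thesis
    using open_subgroupD(4)[OF assms] by (auto simp: closedin_def)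
qed


section \<open>Cosets of open subgroups\<close>

definition coset :: "('k, 'n) sqmat \<Rightarrow> ('k, 'n) sqmat set \<Rightarrow> ('k, 'n) sqmat set" where
  "coset g K = (**) g ` K"

lemma cosetI: "k \<in> K \<Longrightarrow> g ** k \<in> coset g K"
  by (simp add: coset_def)

lemma cosetE:
  assumes "x \<in> coset g K" obtains k where "k \<in> K" "x = g ** k"
  using assms by (auto simp: coset_def)

lemma coset_mono: "K \<subseteq> L \<Longrightarrow> coset g K \<subseteq> coset g L"
  by (auto simp: coset_def)

lemma openin_coset: "openin T U \<Longrightarrow> g \<in> G \<Longrightarrow> openin T (coset g U)"
  unfolding coset_def by (rule openin_translate_left)

lemma mem_coset_self: "open_subgroup K \<Longrightarrow> g \<in> coset g K"
  using open_subgroupD(3) cosetI[of "mat 1" K g] by simp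

lemma coset_eqI:
  assumes K: "open_subgroup K" and g: "g \<in> G" and x: "x \<in> coset g K"
  shows "coset x K = coset g K"
proof -
  obtain k where k: "k \<in> K" "x = g ** k" using x by (rule cosetE)
  have "k \<in> G" using open_subgroupD(4)[OF K] k by simp
  show ?thesis
  proof (intro equalityI subsetI)
    fix y assume "y \<in> coset x K"
    then obtain l where l: "l \<in> K" "y = x ** l" by (rule cosetE)
    show "y \<in> coset g K"
      using cosetI[of "k ** l" K g] k l open_subgroupD(5)[OF K] by (simp add: assoc)
  next
    fix y assume "y \<in> coset g K"
    then obtain l where l: "l \<in> K" "y = g ** l" by (rule cosetE)
    then show "y \<in> coset x K"
      using cosetI[of "matrix_inv k ** l" K x] k open_subgroupD(5,6)[OF K] \<open>k \<in> G\<close> g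
      by (simp add: assoc)
  qed
qed

text \<open>Cosets are open, and any two of them are disjoint or equal.  A finite subcover therefore
  becomes a partition when repetitions are dropped.\<close>

lemma coset_decomposition:
  assumes C: "compactin T C" and K: "open_subgroup K" and CK: "\<And>x. x \<in> C \<Longrightarrow> coset x K \<subseteq> C"
  obtains S where "finite S" "S \<subseteq> C" "C = (\<Union>s\<in>S. coset s K)"
    "\<And>s t. s \<in> S \<Longrightarrow> t \<in> S \<Longrightarrow> s \<noteq> t \<Longrightarrow> coset s K \<inter> coset t K = {}"
proof -
  have CG: "C \<subseteq> G" using compactin_subset_topspace[OF C] by simp
  have cover: "C \<subseteq> (\<Union>s\<in>C. coset s K)"
    using mem_coset_self[OF K] by blast
  have "openin T A" if A: "A \<in> (\<lambda>s. coset s K) ` C" for A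
  proof -
    obtain s where "s \<in> C" "A = coset s K" using A by blast
    then show ?thesis using openin_coset[OF open_subgroupD(1)[OF K]] CG by auto
  qed
  from compactinD[OF C this cover] obtain \<F>
    where \<F>: "finite \<F>" "\<F> \<subseteq> (\<lambda>s. coset s K) ` C" "C \<subseteq> \<Union>\<F>" by auto
  from \<F>(2) obtain S where S: "S \<subseteq> C" "inj_on (\<lambda>s. coset s K) S" "\<F> = (\<lambda>s. coset s K) ` S"
    unfolding subset_image_inj by blast
  show thesis
  proof
    show "finite S" using \<F>(1) S by (simp add: finite_image_iff)
    show "S \<subseteq> C" by fact
    show "C = (\<Union>s\<in>S. coset s K)" using \<F>(3) S CK by blast
    fix s t assume st: "s \<in> S" "t \<in> S" "s \<noteq> t"
    show "coset s K \<inter> coset t K = {}"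
    proof (rule ccontr)
      assume "coset s K \<inter> coset t K \<noteq> {}"
      then obtain x where "x \<in> coset s K" "x \<in> coset t K" by blast
      then have "coset s K = coset t K" using coset_eqI[OF K] st S(1) CG by (metis subsetD)
      then show False using st S(2) by (auto dest: inj_onD)
    qed
  qed
qed

lemma open_subgroup_conj:
  assumes K: "open_subgroup K" and g: "g \<in> G"
  shows "open_subgroup ((\<lambda>x. g ** x ** matrix_inv g) ` K)"
  unfolding open_subgroup_def
proof
  note KD = open_subgroupD[OF K]
  show "subgroup ((\<lambda>x. g ** x ** matrix_inv g) ` K) (G_group D)"
    unfolding subgroup_G_group_iff
  proof (intro conjI ballI)
    show "mat 1 \<in> (\<lambda>x. g ** x ** matrix_inv g) ` K"
      using KD(3) g by (intro image_eqI[of _ _ "mat 1"]) auto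
    fix x assume "x \<in> (\<lambda>x. g ** x ** matrix_inv g) ` K"
    then obtain k where k: "k \<in> K" "x = g ** k ** matrix_inv g" by blast
    then show "matrix_inv x \<in> (\<lambda>x. g ** x ** matrix_inv g) ` K"
      using KD(4,6) g by (intro image_eqI[of _ _ "matrix_inv k"]) (auto simp: assoc)
    fix y assume "y \<in> (\<lambda>x. g ** x ** matrix_inv g) ` K"
    then obtain l where l: "l \<in> K" "y = g ** l ** matrix_inv g" by blast
    then show "x ** y \<in> (\<lambda>x. g ** x ** matrix_inv g) ` K"
      using KD(5) g k by (intro image_eqI[of _ _ "k ** l"]) (auto simp: assoc)
  qed (use KD(4) g in auto)
  have "openin T ((\<lambda>x. x ** matrix_inv g) ` (**) g ` K)"
    using openin_translate_right openin_translate_left KD(1) g by simp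
  then show "openin T ((\<lambda>x. g ** x ** matrix_inv g) ` K)"
    by (simp add: image_image)
qed

lemma common_open_subgroup:
  assumes "finite S" "open_subgroup L" "\<And>s. s \<in> S \<Longrightarrow> open_subgroup (K s)"
  obtains M where "open_subgroup M" "M \<subseteq> L" "\<And>s. s \<in> S \<Longrightarrow> M \<subseteq> K s"
proof -
  have "\<exists>M. open_subgroup M \<and> M \<subseteq> L \<and> (\<forall>s\<in>S. M \<subseteq> K s)"
    using assms
  proof (induction S)
    case (insert s S)
    then obtain M where "open_subgroup M" "M \<subseteq> L" "\<forall>s\<in>S. M \<subseteq> K s" by auto
    then show ?case
      using insert open_subgroup_Int[of M "K s"] by (intro exI[of _ "M \<inter> K s"]) auto
  qed auto
  then show thesis using that by blast
qed

lemma coset_in_open: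
  assumes U: "openin T U" and g: "g \<in> U"
  obtains K where "open_subgroup K" "coset g K \<subseteq> U"
proof -
  have gG: "g \<in> G" using openin_G_subset[OF U g] .
  have "openin T (coset (matrix_inv g) U)"
    using openin_coset[OF U] gG by simp
  moreover have "mat 1 \<in> coset (matrix_inv g) U"
    using cosetI[OF g, of "matrix_inv g"] gG by simp
  ultimately obtain K where K: "open_subgroup K" "K \<subseteq> coset (matrix_inv g) U"
    using small_open_subgroup by blast
  have "coset g K \<subseteq> U"
  proof
    fix x assume "x \<in> coset g K"
    then obtain k where k: "k \<in> K" "x = g ** k" by (rule cosetE)
    then obtain u where "u \<in> U" "k = matrix_inv g ** u" using K(2) by (blast elim: cosetE)
    then show "x \<in> U" using gG k by simp
  qed
  then show thesis using that K by blast
qed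

text \<open>An analogue of the Lebesgue number lemma.  Since \<open>K\<close> is contained in each of the finitely
  many groups \<open>K\<^sub>g\<close> belonging to a finite subcover by cosets \<open>g K\<^sub>g\<close>, a coset of \<open>K\<close> that meets
  \<open>g K\<^sub>g\<close> lies in it.\<close>

lemma uniform_coset_refinement:
  assumes C: "compactin T C" and L: "open_subgroup L"
    and U: "\<And>g. g \<in> C \<Longrightarrow> openin T (U g) \<and> g \<in> U g"
  obtains K where "open_subgroup K" "K \<subseteq> L" "\<And>x. x \<in> C \<Longrightarrow> \<exists>g\<in>C. x \<in> U g \<and> coset x K \<subseteq> U g"
proof -
  have CG: "C \<subseteq> G" using compactin_subset_topspace[OF C] by simp
  have "\<exists>K. open_subgroup K \<and> coset g K \<subseteq> U g" if "g \<in> C" for g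
    using coset_in_open U[OF that] by metis
  then obtain Kf where Kf: "\<And>g. g \<in> C \<Longrightarrow> open_subgroup (Kf g)"
      "\<And>g. g \<in> C \<Longrightarrow> coset g (Kf g) \<subseteq> U g"
    by metis
  have cover: "C \<subseteq> (\<Union>g\<in>C. coset g (Kf g))"
  proof
    fix g assume g: "g \<in> C"
    show "g \<in> (\<Union>g\<in>C. coset g (Kf g))"
      using g mem_coset_self[OF Kf(1)[OF g]] by blast
  qed
  have "openin T A" if A: "A \<in> (\<lambda>g. coset g (Kf g)) ` C" for A
  proof -
    obtain g where "g \<in> C" "A = coset g (Kf g)" using A by blast
    then show ?thesis using openin_coset[OF open_subgroupD(1)[OF Kf(1)]] CG by auto
  qed
  from compactinD[OF C this cover] obtain \<F>
    where \<F>: "finite \<F>" "\<F> \<subseteq> (\<lambda>g. coset g (Kf g)) ` C" "C \<subseteq> \<Union>\<F>" by auto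
  from finite_subset_image[OF \<F>(1,2)] obtain S where
    S: "S \<subseteq> C" "finite S" "\<F> = (\<lambda>g. coset g (Kf g)) ` S" by blast
  obtain K where K: "open_subgroup K" "K \<subseteq> L" "\<And>g. g \<in> S \<Longrightarrow> K \<subseteq> Kf g"
    using common_open_subgroup[OF S(2) L, of Kf] Kf(1) S(1) by blast
  have "\<exists>g\<in>C. x \<in> U g \<and> coset x K \<subseteq> U g" if x: "x \<in> C" for x
  proof -
    obtain g where g: "g \<in> S" "x \<in> coset g (Kf g)"
      using x \<F>(3) S(3) by blast
    then have gC: "g \<in> C" using S(1) by blast
    have "coset x K \<subseteq> coset x (Kf g)" using coset_mono K(3)[OF g(1)] by blast
    also have "\<dots> = coset g (Kf g)"
      using coset_eqI[OF Kf(1)[OF gC] _ g(2)] gC CG by blast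
    finally show ?thesis using Kf(2)[OF gC] g(2) gC by blast
  qed
  then show thesis using that K(1,2) by blast
qed

lemma open_compact_subset: "open_compact D X \<Longrightarrow> X \<subseteq> G"
  unfolding open_compact_def using openin_subset[of T X] by simp

lemma open_compact_right_invariant:
  assumes X: "open_compact D X"
  obtains K where "open_subgroup K" "\<And>x. x \<in> X \<Longrightarrow> coset x K \<subseteq> X"
proof -
  obtain L where L: "open_subgroup L"
    using small_open_subgroup[of G] openin_topspace[of T] by auto
  obtain K where "open_subgroup K" "\<And>x. x \<in> X \<Longrightarrow> coset x K \<subseteq> X"
  proof (rule uniform_coset_refinement[of X L "\<lambda>_. X"])
    show "compactin T X" "\<And>g. g \<in> X \<Longrightarrow> openin T X \<and> g \<in> X"
      using X by (simp_all add: open_compact_def)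
  qed (use L in auto)
  then show thesis by (rule that)
qed

section \<open>Locally constant functions\<close>

lemma hecke_locally_constant:
  assumes "f \<in> hecke D" "g \<in> G"
  obtains U where "openin T U" "g \<in> U" "\<forall>h\<in>U. f h = f g"
proof -
  have "\<forall>g\<in>G. \<exists>U. openin T U \<and> g \<in> U \<and> (\<forall>h\<in>U. f h = f g)"
    using assms(1) by (simp add: hecke_def)
  with assms(2) that show thesis by blast
qed

lemma hecke_zero: "f \<in> hecke D \<Longrightarrow> g \<notin> G \<Longrightarrow> f g = 0"
  by (simp add: hecke_def)

lemma hecke_support_compact:
  assumes "f \<in> hecke D" shows "compactin T {g. f g \<noteq> 0}"
proof -
  obtain C where C: "compactin T C" "\<And>g. f g \<noteq> 0 \<Longrightarrow> g \<in> C"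
    using assms by (auto simp: hecke_def)
  have "\<exists>U. openin T U \<and> g \<in> U \<and> U \<subseteq> G - {g. f g \<noteq> 0}" if g: "g \<in> G - {g. f g \<noteq> 0}" for g
  proof -
    obtain U where U: "openin T U" "g \<in> U" "\<forall>h\<in>U. f h = f g"
      using hecke_locally_constant[OF assms] g by blast
    have "f h = 0" if "h \<in> U" for h using U(3) g that by force
    then show ?thesis using U(1,2) openin_G_subset[OF U(1)] by blast
  qed
  then have "openin T (G - {g. f g \<noteq> 0})"
    by (subst openin_subopen) blast
  moreover have "{g. f g \<noteq> 0} \<subseteq> G" using hecke_zero[OF assms] by blast
  ultimately have "closedin T {g. f g \<noteq> 0}" by (simp add: closedin_def)
  moreover have "{g. f g \<noteq> 0} \<subseteq> C" using C(2) by blast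
  ultimately show ?thesis using closed_compactin[OF C(1)] by simp
qed

text \<open>The sets \<open>U g\<close> may be shrunk until \<open>f\<close> is constant on each of them.  Applying the uniform
  refinement to the support then makes \<open>f\<close> constant on the cosets of one subgroup, and finitely many
  of these fill the support.  The freedom in \<open>U\<close> and \<open>L\<close> allows the cosets to be
  as small as an application requires.\<close>

lemma hecke_coset_expansion:
  assumes f: "f \<in> hecke D" and L: "open_subgroup L"
    and U: "\<And>g. f g \<noteq> 0 \<Longrightarrow> openin T (U g) \<and> g \<in> U g"
  shows "\<exists>K S. open_subgroup K \<and> K \<subseteq> L \<and> finite S \<and> S \<subseteq> G \<and>
    (\<forall>s\<in>S. \<exists>g. f g \<noteq> 0 \<and> coset s K \<subseteq> U g) \<and>
    f = (\<Sum>s\<in>S. (\<lambda>x. f s * indicator (coset s K) x))"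
proof -
  let ?C = "{g. f g \<noteq> 0}"
  have CG: "?C \<subseteq> G"
    using compactin_subset_topspace[OF hecke_support_compact[OF f]] by simp
  have "\<exists>V. openin T V \<and> g \<in> V \<and> V \<subseteq> U g \<and> (\<forall>h\<in>V. f h = f g)" if g: "f g \<noteq> 0" for g
  proof -
    obtain V where V: "openin T V" "g \<in> V" "\<forall>h\<in>V. f h = f g"
      using hecke_locally_constant[OF f] g CG by blast
    have "openin T (V \<inter> U g)" "g \<in> V \<inter> U g" using V U[OF g] by auto
    then show ?thesis using V(3) by blast
  qed
  then obtain V where V: "\<And>g. f g \<noteq> 0 \<Longrightarrow> openin T (V g) \<and> g \<in> V g"
      "\<And>g. f g \<noteq> 0 \<Longrightarrow> V g \<subseteq> U g" "\<And>g h. f g \<noteq> 0 \<Longrightarrow> h \<in> V g \<Longrightarrow> f h = f g"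
    by metis
  obtain K where K: "open_subgroup K" "K \<subseteq> L"
      "\<And>x. x \<in> ?C \<Longrightarrow> \<exists>g\<in>?C. x \<in> V g \<and> coset x K \<subseteq> V g"
    using uniform_coset_refinement[OF hecke_support_compact[OF f] L, of V] V(1) by blast
  have loc: "\<exists>g. f g \<noteq> 0 \<and> coset x K \<subseteq> U g \<and> (\<forall>h\<in>coset x K. f h = f x)" if x: "f x \<noteq> 0" for x
  proof -
    obtain g where "f g \<noteq> 0" "x \<in> V g" "coset x K \<subseteq> V g" using K(3)[of x] x by blast
    then show ?thesis using V(2,3)[of g] by (metis subset_iff)
  qed
  have "coset x K \<subseteq> ?C" if "x \<in> ?C" for x
    using loc[of x] that by auto
  from coset_decomposition[OF hecke_support_compact[OF f] K(1) this]
  obtain S where S: "finite S" "S \<subseteq> ?C" "?C = (\<Union>s\<in>S. coset s K)"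
    "\<And>s t. s \<in> S \<Longrightarrow> t \<in> S \<Longrightarrow> s \<noteq> t \<Longrightarrow> coset s K \<inter> coset t K = {}"
    by blast
  have "f x = (\<Sum>s\<in>S. f s * indicator (coset s K) x)" for x
  proof (cases "f x = 0")
    case True
    then have "x \<notin> coset s K" if "s \<in> S" for s using that S(3) by blast
    then show ?thesis using True by simp
  next
    case False
    then obtain s where s: "s \<in> S" "x \<in> coset s K" using S(3) by blast
    have "f s \<noteq> 0" using s S(2) by blast
    then have fs: "f x = f s" using loc[of s] s by blast
    have "x \<notin> coset t K" if "t \<in> S - {s}" for t using that S(4)[of s t] s by blast
    then have zero: "(\<Sum>t\<in>S - {s}. f t * indicator (coset t K) x) = 0"
      by (intro sum.neutral) simp
    have "(\<Sum>t\<in>S. f t * indicator (coset t K) x) =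
        f s * indicator (coset s K) x + (\<Sum>t\<in>S - {s}. f t * indicator (coset t K) x)"
      by (rule sum.remove[OF S(1) s(1)])
    then show ?thesis
      unfolding zero using s(2) fs by simp
  qed
  then have "f = (\<Sum>s\<in>S. (\<lambda>x. f s * indicator (coset s K) x))"
    unfolding fun_eq_iff sum_pointwise by blast
  moreover have "\<forall>s\<in>S. \<exists>g. f g \<noteq> 0 \<and> coset s K \<subseteq> U g"
    using loc S(2) by blast
  moreover have "S \<subseteq> G" using S(2) CG by blast
  ultimately show ?thesis using K(1,2) S(1) by (intro exI conjI)
qed

lemma indicator_hecke:
  assumes "open_compact D X" shows "(indicator X :: _ \<Rightarrow> 'r::comm_ring_1) \<in> hecke D"
proof -
  have X: "openin T X" "compactin T X" "X \<subseteq> G"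
    using assms open_compact_subset[OF assms] unfolding open_compact_def by blast+
  obtain K where K: "open_subgroup K" "\<And>x. x \<in> X \<Longrightarrow> coset x K \<subseteq> X"
    using open_compact_right_invariant[OF assms] by blast
  have loc: "\<exists>U. openin T U \<and> g \<in> U \<and> (\<forall>h\<in>U. indicator X h = (indicator X g :: 'r))"
    if g: "g \<in> G" for g
  proof (intro exI conjI ballI)
    show "openin T (coset g K)" using openin_coset open_subgroupD(1)[OF K(1)] g by blast
    show gK: "g \<in> coset g K" using mem_coset_self[OF K(1)] .
    fix h assume h: "h \<in> coset g K"
    have "h \<in> X \<longleftrightarrow> g \<in> X"
      using coset_eqI[OF K(1) g h] K(2) h gK by blast
    then show "indicator X h = (indicator X g :: 'r)" unfolding indicator_def by (rule arg_cong)
  qed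
  show ?thesis
    unfolding hecke_def
  proof (intro CollectI conjI allI impI ballI)
    show "indicator X g = (0 :: 'r)" if "g \<notin> G" for g
      using that X(3) by (auto simp: indicator_def)
    show "\<exists>C. compactin T C \<and> (\<forall>g. indicator X g \<noteq> (0 :: 'r) \<longrightarrow> g \<in> C)"
      using X(2) by (intro exI[of _ X]) (auto simp: indicator_def)
    show "\<exists>U. openin T U \<and> g \<in> U \<and> (\<forall>h\<in>U. indicator X h = (indicator X g :: 'r))"
      if "g \<in> G" for g using loc[OF that] .
  qed
qed

end


section \<open>The twist, the Iwahori subgroup and the Haar measure\<close>

locale hecke_setting = padic_group D
  for D :: "('k::alg_closed_field, 'n::finite) padic_datum" +
  fixes P :: "('k, 'n) sqmat set"
    and \<mu> :: "('k, 'n) sqmat set \<Rightarrow> rat"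
    and \<omega> :: "('k, 'n) sqmat \<Rightarrow> 'r::comm_ring_1"
  assumes twist: "is_twist D"
    and pro_p_iwahori: "is_pro_p_iwahori D P"
    and haar: "is_haar D P \<mu>"
    and p_invertible: "\<exists>r::'r. of_nat (residue_char D) * r = 1"
    and smooth_char: "is_smooth_char D \<omega>"
begin

abbreviation \<theta> where "\<theta> \<equiv> twist D"
abbreviation p where "p \<equiv> residue_char D"
abbreviation I where "I \<equiv> iwahori D"

lemma theta_hom: "\<theta> \<in> hom (G_group D) (G_group D)" and theta_bij: "bij_betw \<theta> G G"
  using twist by (auto simp: is_twist_def iso_def)

lemma theta_G [simp]: "x \<in> G \<Longrightarrow> \<theta> x \<in> G"
  using theta_hom by (auto simp: hom_def)

lemma theta_mult [simp]: "x \<in> G \<Longrightarrow> y \<in> G \<Longrightarrow> \<theta> (x ** y) = \<theta> x ** \<theta> y"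
  using hom_mult[OF theta_hom, of x y] by simp

lemma theta_one [simp]: "\<theta> (mat 1) = mat 1"
  using theta_mult[of "mat 1" "mat 1"] inv_l'[of "\<theta> (mat 1)" "\<theta> (mat 1)"] by simp

lemma theta_inv [simp]: "x \<in> G \<Longrightarrow> \<theta> (matrix_inv x) = matrix_inv (\<theta> x)"
  using theta_mult[of x "matrix_inv x"] by (intro inv_eqI[symmetric]) simp_all

lemma theta_inj: "x \<in> G \<Longrightarrow> y \<in> G \<Longrightarrow> \<theta> x = \<theta> y \<Longrightarrow> x = y"
  using theta_bij by (auto simp: bij_betw_def inj_on_def)

lemma openin_theta: "openin T U \<Longrightarrow> openin T (\<theta> ` U)"
  using twist homeomorphic_imp_open_map[of T T \<theta>] by (simp add: is_twist_def open_map_def)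

lemma continuous_theta: "continuous_map T T \<theta>"
  using twist homeomorphic_imp_continuous_map[of T T \<theta>] by (simp add: is_twist_def)

lemma open_compact_theta: "open_compact D X \<Longrightarrow> open_compact D (\<theta> ` X)"
  using openin_theta image_compactin[OF _ continuous_theta] by (auto simp: open_compact_def)

lemma theta_coset:
  assumes "open_subgroup K" "s \<in> G"
  shows "\<theta> ` coset s K = coset (\<theta> s) (\<theta> ` K)"
  using open_subgroupD(4)[OF assms(1)] assms(2) by (force simp: coset_def image_image)

lemma theta_iwahori: "\<theta> ` I = I"
  using twist by (simp add: is_twist_def)

lemma open_subgroup_P: "open_subgroup P" and compact_P: "compactin T P"
  and normal_P: "P \<lhd> (GLn\<lparr>carrier := I\<rparr>)" and finite_index_P: "finite (rcosets\<^bsub>GLn\<lparr>carrier := I\<rparr>\<^esub> P)"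
  using pro_p_iwahori by (auto simp: is_pro_p_iwahori_def pro_p_group_def open_subgroup_def)

lemma P_subset_I: "P \<subseteq> I"
  using normal_imp_subgroup[OF normal_P] subgroup.subset by fastforce

lemma Z0_subset_G: "Z0 D \<subseteq> G"
  by (auto simp: Z0_def kottwitz_kernel_def Let_def points_def Z_alg_def centralizer_def G_set_def)

text \<open>The generators of \<open>I\<close>, namely \<open>Z\<^sub>0\<close> and parts of the groups of rational points of the root
  groups, lie in \<open>G\<close>.\<close>

lemma subgroup_I: "subgroup I GLn" and I_subset_G: "I \<subseteq> G"
proof -
  have gens: "Z0 D \<union> {u. \<exists>a. (a, u) \<in> root_elts D \<and> (\<forall>x\<in>alcove D. aff_fun D a u x \<ge> 0)} \<subseteq> G"
    using Z0_subset_G by (auto simp: root_elts_def U_root_def)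
  then show "I \<subseteq> G"
    unfolding iwahori_def parahoric_def
    by (rule group.generate_subgroup_incl[OF group_GLn _ subgroup_G])
  show "subgroup I GLn"
    unfolding iwahori_def parahoric_def
    using gens subgroup.subset[OF subgroup_G]
    by (intro group.generate_is_subgroup[OF group_GLn]) blast
qed

lemma I_mult: "x \<in> I \<Longrightarrow> y \<in> I \<Longrightarrow> x ** y \<in> I"
  using subgroup.m_closed[OF subgroup_I] by (simp add: GLn_def)

lemma I_inv: "x \<in> I \<Longrightarrow> matrix_inv x \<in> I"
  using subgroup.m_inv_closed[OF subgroup_I, of x] inv_GLn[of x] G_det[of x] I_subset_G by auto

lemma rcosets_GLn:
  "rcosets\<^bsub>GLn\<lparr>carrier := H\<rparr>\<^esub> A = (\<lambda>a. (\<lambda>x. x ** a) ` A) ` H"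
  by (auto simp: RCOSETS_def r_coset_def GLn_def image_def)

lemma iwahori_rcosets: "I = \<Union>(rcosets\<^bsub>GLn\<lparr>carrier := I\<rparr>\<^esub> P)"
proof (intro equalityI subsetI)
  fix i assume i: "i \<in> I"
  then have "i \<in> (\<lambda>x. x ** i) ` P"
    using open_subgroupD(3)[OF open_subgroup_P] by (intro image_eqI[of _ _ "mat 1"]) auto
  then show "i \<in> \<Union>(rcosets\<^bsub>GLn\<lparr>carrier := I\<rparr>\<^esub> P)"
    using i by (auto simp: rcosets_GLn)
qed (use P_subset_I I_mult in \<open>auto simp: rcosets_GLn\<close>)

lemma open_compact_P: "open_compact D P"
  using open_subgroupD(1)[OF open_subgroup_P] compact_P by (simp add: open_compact_def)

text \<open>As \<open>P\<close> has finite index in \<open>I\<close>, the group \<open>I\<close> is a finite union of translates of \<open>P\<close>.\<close>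

lemma open_compact_I: "open_compact D I"
proof -
  have oc: "open_compact D A" if "A \<in> rcosets\<^bsub>GLn\<lparr>carrier := I\<rparr>\<^esub> P" for A
  proof -
    obtain i where "i \<in> I" "A = (\<lambda>x. x ** i) ` P"
      using \<open>A \<in> _\<close> by (auto simp: rcosets_GLn)
    then show ?thesis
      using open_compact_translate_right[OF open_compact_P] I_subset_G by blast
  qed
  have "openin T (\<Union>(rcosets\<^bsub>GLn\<lparr>carrier := I\<rparr>\<^esub> P))"
    using oc by (auto simp: open_compact_def)
  moreover have "compactin T (\<Union>(rcosets\<^bsub>GLn\<lparr>carrier := I\<rparr>\<^esub> P))"
    using oc by (intro compactin_Union finite_index_P) (auto simp: open_compact_def)
  ultimately show ?thesis
    using iwahori_rcosets by (simp add: open_compact_def)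
qed

lemma open_subgroup_I: "open_subgroup I"
  unfolding open_subgroup_def subgroup_G_group_iff
  using open_compact_I I_subset_G I_mult I_inv open_subgroupD(3)[OF open_subgroup_P] P_subset_I
  by (auto simp: open_compact_def)

lemma open_compact_small:
  assumes "open_subgroup K" "K \<subseteq> P" shows "open_compact D K"
  using closed_compactin[OF compact_P assms(2) closedin_open_subgroup[OF assms(1)]]
    open_subgroupD(1)[OF assms(1)] by (simp add: open_compact_def)

lemma open_compact_coset: "open_compact D K \<Longrightarrow> s \<in> G \<Longrightarrow> open_compact D (coset s K)"
  unfolding coset_def by (rule open_compact_translate_left)

lemma mu_disjoint: "open_compact D X \<Longrightarrow> open_compact D Y \<Longrightarrow> X \<inter> Y = {} \<Longrightarrow> \<mu> (X \<union> Y) = \<mu> X + \<mu> Y"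
  using haar by (simp add: is_haar_def)

lemma mu_left: "open_compact D X \<Longrightarrow> g \<in> G \<Longrightarrow> \<mu> (coset g X) = \<mu> X"
  and mu_right: "open_compact D X \<Longrightarrow> g \<in> G \<Longrightarrow> \<mu> ((\<lambda>x. x ** g) ` X) = \<mu> X"
  using haar by (simp_all add: is_haar_def coset_def)

lemma mu_empty [simp]: "\<mu> {} = 0"
  using mu_disjoint[of "{}" "{}"] by (simp add: open_compact_def)

lemma mu_disjoint_union:
  assumes "finite S" "\<And>s. s \<in> S \<Longrightarrow> open_compact D (A s)"
    and "\<And>s t. s \<in> S \<Longrightarrow> t \<in> S \<Longrightarrow> s \<noteq> t \<Longrightarrow> A s \<inter> A t = {}"
  shows "open_compact D (\<Union>s\<in>S. A s)" "\<mu> (\<Union>s\<in>S. A s) = (\<Sum>s\<in>S. \<mu> (A s))"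
proof -
  have "open_compact D (\<Union>s\<in>S. A s) \<and> \<mu> (\<Union>s\<in>S. A s) = (\<Sum>s\<in>S. \<mu> (A s))"
    using assms
  proof (induction S)
    case empty
    show ?case by (simp add: open_compact_def)
  next
    case (insert s S)
    then have IH: "open_compact D (\<Union>s\<in>S. A s)" "\<mu> (\<Union>s\<in>S. A s) = (\<Sum>s\<in>S. \<mu> (A s))"
      by auto
    have s: "open_compact D (A s)" "A s \<inter> (\<Union>s\<in>S. A s) = {}"
      using insert by auto
    have "open_compact D (A s \<union> (\<Union>s\<in>S. A s))"
      using s(1) IH(1) by (auto simp: open_compact_def intro: compactin_Un)
    then show ?case
      using mu_disjoint[OF s(1) IH(1) s(2)] IH(2) insert by simp
  qed
  then show "open_compact D (\<Union>s\<in>S. A s)" "\<mu> (\<Union>s\<in>S. A s) = (\<Sum>s\<in>S. \<mu> (A s))" by auto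
qed

text \<open>The twist maps a partition of \<open>I\<close> into cosets of \<open>K\<close> to a partition of \<open>\<theta>(I) = I\<close> into
  equally many cosets of \<open>\<theta>(K)\<close>; both compute the volume of \<open>I\<close>.  The argument works with \<open>I\<close> and not
  with \<open>P\<close>, because it is \<open>I\<close> that is known to be stable under the twist.\<close>

lemma mu_theta:
  assumes K: "open_subgroup K" "K \<subseteq> P"
  shows "\<mu> (\<theta> ` K) = \<mu> K"
proof -
  have "coset x K \<subseteq> I" if "x \<in> I" for x
    using that K(2) P_subset_I I_mult by (auto simp: coset_def)
  moreover have "compactin T I" using open_compact_I by (simp add: open_compact_def)
  ultimately obtain S where S: "finite S" "S \<subseteq> I" "I = (\<Union>s\<in>S. coset s K)"
    "\<And>s t. s \<in> S \<Longrightarrow> t \<in> S \<Longrightarrow> s \<noteq> t \<Longrightarrow> coset s K \<inter> coset t K = {}"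
    using coset_decomposition[OF _ K(1)] by metis
  have SG: "s \<in> G" if "s \<in> S" for s using that S(2) I_subset_G by blast
  note oc = open_compact_small[OF K]
  have "\<mu> I = (\<Sum>s\<in>S. \<mu> (coset s K))"
    unfolding S(3) using S SG oc by (intro mu_disjoint_union(2) open_compact_coset) auto
  also have "\<dots> = of_nat (card S) * \<mu> K"
    using mu_left[OF oc] SG by simp
  finally have 1: "\<mu> I = of_nat (card S) * \<mu> K" .
  have "I = (\<Union>s\<in>S. \<theta> ` coset s K)"
    using theta_iwahori S(3) by (metis image_UN)
  moreover have "\<mu> (\<Union>s\<in>S. \<theta> ` coset s K) = (\<Sum>s\<in>S. \<mu> (\<theta> ` coset s K))"
  proof (rule mu_disjoint_union(2))
    fix s assume "s \<in> S"
    then show "open_compact D (\<theta> ` coset s K)"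
      using open_compact_theta open_compact_coset oc SG by blast
  next
    fix s t assume st: "s \<in> S" "t \<in> S" "s \<noteq> t"
    have "coset s K \<subseteq> G" "coset t K \<subseteq> G"
      using st SG open_subgroupD(4)[OF K(1)] by (auto simp: coset_def)
    then show "\<theta> ` coset s K \<inter> \<theta> ` coset t K = {}"
      using S(4)[OF st] theta_inj by blast
  qed (rule S(1))
  moreover have "(\<Sum>s\<in>S. \<mu> (\<theta> ` coset s K)) = of_nat (card S) * \<mu> (\<theta> ` K)"
    using theta_coset[OF K(1)] mu_left[OF open_compact_theta[OF oc]] SG by simp
  ultimately have 2: "\<mu> I = of_nat (card S) * \<mu> (\<theta> ` K)" by simp
  have "card S \<noteq> 0"
    using S(1,3) open_subgroupD(3)[OF open_subgroup_I] by auto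
  then show ?thesis using 1 2 by simp
qed

text \<open>The normalisation of the measure gives \<open>\<mu>(K) = 1 / [P : K]\<close>, and open subgroups of a pro-\<open>p\<close>
  group have \<open>p\<close>-power index.\<close>

lemma mu_small:
  assumes K: "open_subgroup K" "K \<subseteq> P"
  shows "\<exists>k. \<mu> K = 1 / of_nat p ^ k"
proof -
  have "openin (subtopology T P) K"
    using open_subgroupD(1)[OF K(1)] K(2) by (auto simp: openin_subtopology)
  then obtain k where k: "group_index P K = p ^ k"
    using pro_p_iwahori K open_subgroupD(2)[OF K(1)]
    unfolding is_pro_p_iwahori_def pro_p_group_def by blast
  have "(\<lambda>x. x ** a) ` K = K" if a: "a \<in> K" for a
  proof (intro equalityI subsetI)
    fix x assume "x \<in> K"
    then show "x \<in> (\<lambda>x. x ** a) ` K"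
      using a open_subgroupD(4-6)[OF K(1)]
      by (intro image_eqI[of _ _ "x ** matrix_inv a"]) (auto simp: assoc)
  qed (use a open_subgroupD(5)[OF K(1)] in auto)
  then have "rcosets\<^bsub>GLn\<lparr>carrier := K\<rparr>\<^esub> K = {K}"
    using open_subgroupD(3)[OF K(1)] by (auto simp: rcosets_GLn)
  then have "group_index K K = 1" by (simp add: group_index_def)
  moreover have "\<mu> K = of_nat (group_index K (K \<inter> P)) / of_nat (group_index P (K \<inter> P))"
    using haar open_compact_small[OF K] open_subgroupD(2)[OF K(1)] unfolding is_haar_def by blast
  ultimately show ?thesis
    using K(2) k by (intro exI[of _ k]) (simp add: Int_absorb2)
qed

text \<open>Uniqueness: after bringing two representing fractions to a common denominator, the
  resulting power of \<open>p\<close> can be cancelled because \<open>p\<close> is invertible in the coefficient ring.\<close>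

lemma of_Zp_inv_eqI:
  assumes "q = of_int a / of_nat p ^ k" "(r::'r) * of_nat p ^ k = of_int a"
  shows "of_Zp_inv p q = r"
  unfolding of_Zp_inv_def
proof (rule the_equality)
  fix r' :: 'r
  assume "\<exists>a k. q = of_int a / of_nat p ^ k \<and> r' * of_nat p ^ k = of_int a"
  then obtain b l where b: "q = of_int b / of_nat p ^ l" "r' * of_nat p ^ l = of_int b" by blast
  have p0: "(of_nat p :: rat) \<noteq> 0" using prime_p by (auto simp: prime_gt_0_nat)
  have "of_int (a * int p ^ l) = (of_int (b * int p ^ k) :: rat)"
    using assms(1) b(1) p0 by (simp add: field_simps)
  then have "a * int p ^ l = b * int p ^ k" by (simp only: of_int_eq_iff)
  then have "of_int a * of_nat p ^ l = (of_int b * of_nat p ^ k :: 'r)"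
    by (metis of_int_mult of_int_of_nat_eq of_int_power)
  then have "(r * of_nat p ^ k) * of_nat p ^ l = (r' * of_nat p ^ l) * of_nat p ^ k"
    using assms(2) b(2) by simp
  then have eq: "r * of_nat p ^ (k + l) = r' * of_nat p ^ (k + l)"
    by (simp add: power_add algebra_simps)
  obtain u :: 'r where "of_nat p * u = 1" using p_invertible by blast
  then have "of_nat p ^ (k + l) * u ^ (k + l) = 1"
    by (simp add: power_mult_distrib[symmetric])
  then show "r' = r" using eq by (metis mult.assoc mult.right_neutral)
qed (use assms in blast)

lemma of_Zp_inv_zero [simp]: "of_Zp_inv p 0 = (0 :: 'r)"
  by (rule of_Zp_inv_eqI[of _ 0 0]) auto

lemma of_Zp_inv_mu_unit:
  assumes K: "open_subgroup K" "K \<subseteq> P"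
  shows "\<exists>u::'r. u * of_Zp_inv p (\<mu> K) = 1"
proof -
  obtain k where k: "\<mu> K = 1 / of_nat p ^ k" using mu_small[OF K] ..
  obtain u :: 'r where "of_nat p * u = 1" using p_invertible by blast
  then have u: "u ^ k * of_nat p ^ k = 1"
    by (simp add: power_mult_distrib[symmetric] mult.commute)
  have "of_Zp_inv p (\<mu> K) = u ^ k"
    using k u by (intro of_Zp_inv_eqI[of _ 1 k]) auto
  then show ?thesis using u by (metis mult.commute)
qed


section \<open>The twisted cocenter\<close>

abbreviation (input) scale :: "'r \<Rightarrow> (('k, 'n) sqmat \<Rightarrow> 'r) \<Rightarrow> ('k, 'n) sqmat \<Rightarrow> 'r" where
  "scale \<equiv> (\<lambda>c f g. c * f g)"

interpretation R: module scale
  by (rule module_functions)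

lemma subspace_hecke: "R.subspace (hecke D)"
proof (rule R.subspaceI)
  have "compactin T {}" by simp
  moreover have "\<exists>U. openin T U \<and> g \<in> U" if "g \<in> G" for g
    using that openin_topspace[of T] by auto
  ultimately show "(0 :: ('k, 'n) sqmat \<Rightarrow> 'r) \<in> hecke D" by (auto simp: hecke_def)
next
  fix f h :: "('k, 'n) sqmat \<Rightarrow> 'r" assume f: "f \<in> hecke D" and h: "h \<in> hecke D"
  show "f + h \<in> hecke D"
    unfolding hecke_def
  proof (intro CollectI conjI allI impI ballI)
    show "(f + h) g = 0" if "g \<notin> G" for g using that hecke_zero[OF f] hecke_zero[OF h] by simp
    have C: "compactin T ({g. f g \<noteq> 0} \<union> {g. h g \<noteq> 0})"
      using hecke_support_compact f h by (intro compactin_Un)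
    show "\<exists>C. compactin T C \<and> (\<forall>g. (f + h) g \<noteq> 0 \<longrightarrow> g \<in> C)"
      by (rule exI, rule conjI, rule C) auto
    fix g assume g: "g \<in> G"
    obtain U where U: "openin T U" "g \<in> U" "\<forall>x\<in>U. f x = f g"
      using hecke_locally_constant[OF f g] .
    obtain V where V: "openin T V" "g \<in> V" "\<forall>x\<in>V. h x = h g"
      using hecke_locally_constant[OF h g] .
    show "\<exists>U. openin T U \<and> g \<in> U \<and> (\<forall>x\<in>U. (f + h) x = (f + h) g)"
    proof (intro exI conjI ballI)
      show "openin T (U \<inter> V)" "g \<in> U \<inter> V" using U V by auto
      fix x assume "x \<in> U \<inter> V"
      then have "f x = f g" "h x = h g" using U(3) V(3) by blast+
      then show "(f + h) x = (f + h) g" by (simp only: plus_fun_def)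
    qed
  qed
next
  fix c :: 'r and f :: "('k, 'n) sqmat \<Rightarrow> 'r" assume f: "f \<in> hecke D"
  show "scale c f \<in> hecke D"
    unfolding hecke_def
  proof (intro CollectI conjI allI impI ballI)
    show "c * f g = 0" if "g \<notin> G" for g using that hecke_zero[OF f] by simp
    show "\<exists>C. compactin T C \<and> (\<forall>g. c * f g \<noteq> 0 \<longrightarrow> g \<in> C)"
      by (rule exI, rule conjI, rule hecke_support_compact[OF f]) auto
    fix g assume g: "g \<in> G"
    obtain U where U: "openin T U" "g \<in> U" "\<forall>x\<in>U. f x = f g"
      using hecke_locally_constant[OF f g] .
    show "\<exists>U. openin T U \<and> g \<in> U \<and> (\<forall>x\<in>U. c * f x = c * f g)"
    proof (intro exI conjI ballI)
      fix x assume "x \<in> U"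
      then have "f x = f g" using U(3) by blast
      then show "c * f x = c * f g" by (rule arg_cong)
    qed (fact U(1,2))+
  qed
qed

lemma subspace_hecke_supp: "R.subspace (hecke_supp D X)"
proof (rule R.subspaceI)
  show "(0 :: ('k, 'n) sqmat \<Rightarrow> 'r) \<in> hecke_supp D X"
    using R.subspace_0[OF subspace_hecke] by (simp add: hecke_supp_def)
next
  fix f h :: "('k, 'n) sqmat \<Rightarrow> 'r" assume fh: "f \<in> hecke_supp D X" "h \<in> hecke_supp D X"
  have "f g \<noteq> 0 \<or> h g \<noteq> 0" if "(f + h) g \<noteq> 0" for g using that by auto
  then show "f + h \<in> hecke_supp D X"
    using fh R.subspace_add[OF subspace_hecke] unfolding hecke_supp_def by blast
next
  fix c :: 'r and f :: "('k, 'n) sqmat \<Rightarrow> 'r" assume f: "f \<in> hecke_supp D X"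
  have "f g \<noteq> 0" if "c * f g \<noteq> 0" for g using that by auto
  then show "scale c f \<in> hecke_supp D X"
    using f R.subspace_scale[OF subspace_hecke] unfolding hecke_supp_def by blast
qed

lemma haar_integral_indicator:
  assumes "X \<subseteq> G"
  shows "haar_integral D \<mu> (indicator X) = (of_Zp_inv p (\<mu> X) :: 'r)"
proof (cases "X = {}")
  case True
  have "(indicator {} :: ('k, 'n) sqmat \<Rightarrow> 'r) ` G - {0} = {}" by auto
  then show ?thesis unfolding haar_integral_def True by simp
next
  case False
  have "(indicator X :: ('k, 'n) sqmat \<Rightarrow> 'r) ` G - {0} = {1}"
  proof (intro equalityI subsetI)
    fix r :: 'r assume "r \<in> {1}"
    moreover obtain x where "x \<in> X" using False by blast
    ultimately show "r \<in> indicator X ` G - {0}"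
      using assms by (auto intro!: image_eqI[of _ _ x])
  qed (auto simp: indicator_def)
  moreover have "{g \<in> G. indicator X g = (1::'r)} = X"
    using assms by (auto simp: indicator_def)
  ultimately show ?thesis by (simp add: haar_integral_def)
qed

lemma convol_indicator:
  "convol D \<mu> (indicator X) (indicator Y) x =
    (if x \<in> G then of_Zp_inv p (\<mu> {y \<in> G. y \<in> X \<and> matrix_inv y ** x \<in> Y}) else (0 :: 'r))"
proof -
  have "(\<lambda>y. if y \<in> G then indicator X y * indicator Y (matrix_inv y ** x) else 0) =
      (indicator {y \<in> G. y \<in> X \<and> matrix_inv y ** x \<in> Y} :: _ \<Rightarrow> 'r)"
    by (auto simp: indicator_def)
  then show ?thesis
    unfolding convol_def by (simp add: haar_integral_indicator)
qed

lemma convol_indicator_zero: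
  assumes "{y \<in> G. y \<in> X \<and> matrix_inv y ** x \<in> Y} = {}"
  shows "convol D \<mu> (indicator X) (indicator Y) x = (0 :: 'r)"
  unfolding convol_indicator assms mu_empty of_Zp_inv_zero by (rule if_cancel)

text \<open>By right invariance \<open>X\<close> is a finite union of cosets \<open>s L\<close>, and \<open>s L\<close> is stable under left
  multiplication by the conjugate \<open>s L s\<inverse>\<close>.  The intersection of these conjugates stabilises \<open>X\<close>.\<close>

lemma open_compact_left_invariant:
  assumes X: "open_compact D X"
  obtains K where "open_subgroup K" "\<And>k x. k \<in> K \<Longrightarrow> x \<in> X \<Longrightarrow> k ** x \<in> X"
proof -
  obtain L where L: "open_subgroup L" "\<And>x. x \<in> X \<Longrightarrow> coset x L \<subseteq> X"
    using open_compact_right_invariant[OF X] by blast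
  have "compactin T X" using X by (simp add: open_compact_def)
  then obtain S where S: "finite S" "S \<subseteq> X" "X = (\<Union>s\<in>S. coset s L)"
    using coset_decomposition[OF _ L] by metis
  have SG: "s \<in> G" if "s \<in> S" for s using that S(2) open_compact_subset[OF X] by blast
  define c where "c s = (\<lambda>l. s ** l ** matrix_inv s) ` L" for s :: "('k, 'n) sqmat"
  have "open_subgroup (c s)" if "s \<in> S" for s
    unfolding c_def using open_subgroup_conj[OF L(1) SG[OF that]] .
  then obtain K where K: "open_subgroup K" "K \<subseteq> L" "\<And>s. s \<in> S \<Longrightarrow> K \<subseteq> c s"
    using common_open_subgroup[OF S(1) L(1), of c] by blast
  have "k ** x \<in> X" if k: "k \<in> K" and x: "x \<in> X" for k x
  proof -
    obtain s where s: "s \<in> S" "x \<in> coset s L" using S(3) x by blast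
    obtain l where l: "l \<in> L" "x = s ** l" using s(2) by (rule cosetE)
    obtain l' where l': "k = s ** l' ** matrix_inv s" "l' \<in> L"
      using subsetD[OF K(3)[OF s(1)] k] unfolding c_def by (rule imageE)
    have "k ** x = s ** (l' ** l)" using l l' SG[OF s(1)] by (simp add: assoc)
    then have "k ** x \<in> coset s L" using cosetI open_subgroupD(5)[OF L(1) l'(2) l(1)] by simp
    then show ?thesis using s(1) S(3) by blast
  qed
  then show thesis using that K(1) by blast
qed

text \<open>Right invariance of \<open>Y\<close> under an open subgroup makes the convolution locally constant.  Left
  invariance of \<open>Y\<close> bounds the support: if \<open>X\<close> is a finite union of cosets \<open>s K\<close> with \<open>K Y = Y\<close>, then
  \<open>X Y\<close> is the finite union of the compact sets \<open>s Y\<close>.  The statement is needed to see that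
  the twisted commutators lie in the Hecke algebra.\<close>

lemma convol_indicator_hecke:
  assumes X: "open_compact D X" and Y: "open_compact D Y"
  shows "convol D \<mu> (indicator X) (indicator Y :: _ \<Rightarrow> 'r) \<in> hecke D"
  unfolding hecke_def
proof (intro CollectI conjI allI impI ballI)
  let ?f = "convol D \<mu> (indicator X) (indicator Y :: _ \<Rightarrow> 'r)"
  have XG: "X \<subseteq> G" and YG: "Y \<subseteq> G" using open_compact_subset X Y by auto
  show "?f g = 0" if "g \<notin> G" for g using that by (simp add: convol_indicator)
  show "\<exists>U. openin T U \<and> g \<in> U \<and> (\<forall>h\<in>U. ?f h = ?f g)" if g: "g \<in> G" for g
  proof -
    obtain K where K: "open_subgroup K" "\<And>x. x \<in> Y \<Longrightarrow> coset x K \<subseteq> Y"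
      using open_compact_right_invariant[OF Y] by blast
    show ?thesis
    proof (intro exI conjI ballI)
      show "openin T (coset g K)" using openin_coset[OF open_subgroupD(1)[OF K(1)] g] .
      show "g \<in> coset g K" using mem_coset_self[OF K(1)] .
      fix h assume "h \<in> coset g K"
      then obtain k where k: "k \<in> K" "h = g ** k" by (rule cosetE)
      have kG: "k \<in> G" using k open_subgroupD(4)[OF K(1)] by blast
      have "matrix_inv y ** h \<in> Y \<longleftrightarrow> matrix_inv y ** g \<in> Y" if "y \<in> G" for y
      proof
        assume "matrix_inv y ** g \<in> Y"
        then have "(matrix_inv y ** g) ** k \<in> Y" using K(2) cosetI[OF k(1)] by blast
        then show "matrix_inv y ** h \<in> Y" by (simp add: k assoc)
      next
        assume "matrix_inv y ** h \<in> Y"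
        then have "(matrix_inv y ** h) ** matrix_inv k \<in> Y"
          using K(2) cosetI[OF open_subgroupD(6)[OF K(1) k(1)]] by blast
        then show "matrix_inv y ** g \<in> Y" using kG by (simp add: k assoc)
      qed
      then have "{y \<in> G. y \<in> X \<and> matrix_inv y ** h \<in> Y} = {y \<in> G. y \<in> X \<and> matrix_inv y ** g \<in> Y}"
        by blast
      then show "?f h = ?f g" using g k(2) kG by (simp add: convol_indicator)
    qed
  qed
  show "\<exists>C. compactin T C \<and> (\<forall>g. ?f g \<noteq> 0 \<longrightarrow> g \<in> C)"
  proof -
    obtain K where K: "open_subgroup K" "\<And>k x. k \<in> K \<Longrightarrow> x \<in> Y \<Longrightarrow> k ** x \<in> Y"
      using open_compact_left_invariant[OF Y] by blast
    obtain L where L: "open_subgroup L" "\<And>x. x \<in> X \<Longrightarrow> coset x L \<subseteq> X"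
      using open_compact_right_invariant[OF X] by blast
    note LK = open_subgroup_Int[OF L(1) K(1)]
    have "coset x (L \<inter> K) \<subseteq> X" if "x \<in> X" for x
      using L(2)[OF that] coset_mono[of "L \<inter> K" L x] by blast
    moreover have "compactin T X" using X by (simp add: open_compact_def)
    ultimately obtain S where S: "finite S" "S \<subseteq> X" "X = (\<Union>s\<in>S. coset s (L \<inter> K))"
      using coset_decomposition[OF _ LK] by metis
    have "compactin T (coset s Y)" if "s \<in> S" for s
      using open_compact_coset[OF Y] that S(2) XG by (auto simp: open_compact_def)
    then have "compactin T (\<Union>s\<in>S. coset s Y)" using S(1) by (intro compactin_Union) auto
    moreover have "g \<in> (\<Union>s\<in>S. coset s Y)" if nz: "?f g \<noteq> 0" for g
    proof -
      have "{y \<in> G. y \<in> X \<and> matrix_inv y ** g \<in> Y} \<noteq> {}"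
      proof
        assume E: "{y \<in> G. y \<in> X \<and> matrix_inv y ** g \<in> Y} = {}"
        show False using nz convol_indicator_zero[OF E] by contradiction
      qed
      then obtain y where y: "y \<in> G" "y \<in> X" "matrix_inv y ** g \<in> Y" by blast
      obtain s where s: "s \<in> S" "y \<in> coset s (L \<inter> K)" using y(2) S(3) by blast
      obtain k where k: "k \<in> L \<inter> K" "y = s ** k" using s(2) by (rule cosetE)
      have sG: "s \<in> G" using s(1) S(2) XG by blast
      have "k ** (matrix_inv y ** g) \<in> Y" using K(2) k y by blast
      then have "s ** (k ** (matrix_inv y ** g)) \<in> coset s Y" by (rule cosetI)
      moreover have "s ** (k ** (matrix_inv y ** g)) = g"
        using y(1) k(2) by (metis inv_r' matrix_mul_assoc)
      ultimately show ?thesis using s(1) by auto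
    qed
    ultimately show ?thesis by blast
  qed
qed

abbreviation N where "N \<equiv> commutator_span D \<mu> \<omega>"

lemma subspace_N: "R.subspace N"
  unfolding commutator_span_def by (rule R.subspace_span)

lemma N_subset_hecke: "N \<subseteq> hecke D"
  unfolding commutator_span_def
proof (rule R.span_minimal[OF _ subspace_hecke], clarify)
  fix X X' x assume "open_compact D X" "open_compact D X'" "x \<in> X"
  then have "convol D \<mu> (indicator X) (indicator X') -
      scale (\<omega> (matrix_inv x)) (convol D \<mu> (indicator X') (indicator (\<theta> ` X))) \<in> hecke D"
    by (intro R.subspace_diff[OF subspace_hecke] R.subspace_scale[OF subspace_hecke]
        convol_indicator_hecke open_compact_theta)
  then show "(\<lambda>g. convol D \<mu> (indicator X) (indicator X') g -
      \<omega> (matrix_inv x) * convol D \<mu> (indicator X') (indicator (\<theta> ` X)) g) \<in> hecke D"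
    by (simp add: fun_diff_def)
qed

text \<open>The commutator is that of the characteristic functions of \<open>x M\<close> and \<open>Y = h K\<close>, for an open
  subgroup \<open>M\<close> of \<open>P\<close> chosen small enough that both convolutions are multiples of characteristic
  functions.  Both multiples equal the volume of \<open>M\<close>, which is invertible.\<close>

lemma twisted_translate_mod_N:
  assumes x: "x \<in> G" and h: "h \<in> G" and K: "open_subgroup K" "K \<subseteq> P"
  shows "(\<lambda>g. indicator (coset x (coset h K)) g -
      \<omega> (matrix_inv x) * indicator ((\<lambda>y. y ** \<theta> x) ` coset h K) g) \<in> N"
proof -
  let ?Y = "coset h K"
  note KD = open_subgroupD[OF K(1)]
  have ocK: "open_compact D K" using open_compact_small[OF K] .
  have ocY: "open_compact D ?Y" using open_compact_coset[OF ocK h] .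
  have YG: "?Y \<subseteq> G" using open_compact_subset[OF ocY] .
  define W where "W = {g \<in> G. \<omega> g = 1}"
  have W: "openin T W" "mat 1 \<in> W"
    using smooth_char by (auto simp: is_smooth_char_def W_def)
  have conj: "open_subgroup ((\<lambda>k. matrix_inv (\<theta> x) ** k ** matrix_inv (matrix_inv (\<theta> x))) ` K)"
    using open_subgroup_conj[OF K(1) G_inv[OF theta_G[OF x]]] .
  \<comment> \<open>For \<open>m\<close> in \<open>V\<close> the element \<open>\<theta>(x m x\<inverse>)\<close> lies in \<open>K\<close>, so it stabilises \<open>Y = h K\<close> from the right.\<close>
  define V where "V = {g \<in> topspace T. \<theta> g \<in> (\<lambda>k. matrix_inv (\<theta> x) ** k ** \<theta> x) ` K}"
  have V: "openin T V" "mat 1 \<in> V"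
    using openin_continuous_map_preimage[OF continuous_theta open_subgroupD(1)[OF conj]]
      open_subgroupD(3)[OF conj] x by (auto simp: V_def)
  \<comment> \<open>This conjugate of \<open>K\<close> stabilises \<open>Y = h K\<close> from the left.\<close>
  have hK: "open_subgroup ((\<lambda>k. h ** k ** matrix_inv h) ` K)"
    using open_subgroup_conj[OF K(1) h] .
  let ?U = "W \<inter> V \<inter> P \<inter> (\<lambda>k. h ** k ** matrix_inv h) ` K"
  have "openin T ?U" "mat 1 \<in> ?U"
    using W V open_subgroupD(1,3)[OF open_subgroup_P] open_subgroupD(1,3)[OF hK] by auto
  then obtain M where M: "open_subgroup M" "M \<subseteq> ?U"
    using small_open_subgroup by blast
  note MD = open_subgroupD[OF M(1)]
  have MP: "M \<subseteq> P" using M(2) by blast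
  have ocM: "open_compact D M" using open_compact_small[OF M(1) MP] .
  have left: "m ** y \<in> ?Y" if m: "m \<in> M" and y: "y \<in> ?Y" for m y
  proof -
    obtain k where k: "k \<in> K" "y = h ** k" using y by (rule cosetE)
    obtain l where l: "l \<in> K" "m = h ** l ** matrix_inv h" using m M(2) by blast
    have "m ** y = h ** (l ** k)" using k l h by (simp add: assoc)
    then show ?thesis using cosetI KD(5)[OF l(1) k(1)] by simp
  qed
  have right: "y ** (\<theta> x ** \<theta> m ** matrix_inv (\<theta> x)) \<in> ?Y" if m: "m \<in> M" and y: "y \<in> ?Y" for m y
  proof -
    obtain k where k: "k \<in> K" "y = h ** k" using y by (rule cosetE)
    obtain l where l: "l \<in> K" "\<theta> m = matrix_inv (\<theta> x) ** l ** \<theta> x"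
      using m M(2) by (auto simp: V_def)
    have "y ** (\<theta> x ** \<theta> m ** matrix_inv (\<theta> x)) = h ** (k ** l)" using k l x by (simp add: assoc)
    then show ?thesis using cosetI KD(5)[OF k(1) l(1)] by simp
  qed
  let ?m = "of_Zp_inv p (\<mu> M) :: 'r"
  have XG: "coset x M \<subseteq> G" using open_compact_subset[OF open_compact_coset[OF ocM x]] .
  have first: "convol D \<mu> (indicator (coset x M)) (indicator ?Y) g = ?m * indicator (coset x ?Y) g" for g
  proof (cases "g \<in> coset x ?Y")
    case True
    then obtain y where y: "y \<in> ?Y" "g = x ** y" by (rule cosetE)
    then have gG: "g \<in> G" using x YG by auto
    have "{z \<in> G. z \<in> coset x M \<and> matrix_inv z ** g \<in> ?Y} = coset x M"
    proof (intro equalityI subsetI)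
      fix z assume z: "z \<in> coset x M"
      then obtain m where m: "m \<in> M" "z = x ** m" by (rule cosetE)
      then have "matrix_inv z ** g = matrix_inv m ** y"
        using y x MD(4) by (simp add: assoc)
      then show "z \<in> {z \<in> G. z \<in> coset x M \<and> matrix_inv z ** g \<in> ?Y}"
        using left[OF MD(6)[OF m(1)] y(1)] z XG by auto
    qed auto
    then show ?thesis using True gG mu_left[OF ocM x] by (simp add: convol_indicator)
  next
    case False
    have "{z \<in> G. z \<in> coset x M \<and> matrix_inv z ** g \<in> ?Y} = {}"
    proof (rule equals0I)
      fix z assume "z \<in> {z \<in> G. z \<in> coset x M \<and> matrix_inv z ** g \<in> ?Y}"
      then have z: "z \<in> G" "z \<in> coset x M" "matrix_inv z ** g \<in> ?Y" by auto
      obtain m where m: "m \<in> M" "z = x ** m" using z(2) by (rule cosetE)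
      have "x ** (m ** (matrix_inv z ** g)) \<in> coset x ?Y" by (intro cosetI left m z)
      moreover have "x ** (m ** (matrix_inv z ** g)) = g"
        using z(1) m(2) by (metis inv_r' matrix_mul_assoc)
      ultimately show False using False by simp
    qed
    from convol_indicator_zero[OF this] show ?thesis using False by simp
  qed
  have second: "convol D \<mu> (indicator ?Y) (indicator (\<theta> ` coset x M)) g =
      ?m * indicator ((\<lambda>y. y ** \<theta> x) ` ?Y) g" for g
  proof (cases "g \<in> (\<lambda>y. y ** \<theta> x) ` ?Y")
    case True
    then obtain y where y: "y \<in> ?Y" "g = y ** \<theta> x" by blast
    have yG: "y \<in> G" using y YG by auto
    then have gG: "g \<in> G" using x y by auto
    let ?Z = "(\<lambda>z. z ** matrix_inv (\<theta> x)) ` coset g (\<theta> ` M)"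
    have "{z \<in> G. z \<in> ?Y \<and> matrix_inv z ** g \<in> \<theta> ` coset x M} = ?Z"
    proof (intro equalityI subsetI)
      fix z assume "z \<in> {z \<in> G. z \<in> ?Y \<and> matrix_inv z ** g \<in> \<theta> ` coset x M}"
      then have z: "z \<in> G" "z \<in> ?Y" "matrix_inv z ** g \<in> coset (\<theta> x) (\<theta> ` M)"
        using theta_coset[OF M(1) x] by auto
      obtain m where m: "m \<in> M" "matrix_inv z ** g = \<theta> x ** \<theta> m"
        using z(3) by (auto elim: cosetE)
      have mG: "m \<in> G" using m MD(4) by blast
      have "g = z ** (\<theta> x ** \<theta> m)" using m(2) z(1) by (metis inv_r')
      then have "z = g ** \<theta> (matrix_inv m) ** matrix_inv (\<theta> x)"
        using x mG by (simp add: assoc)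
      moreover have "g ** \<theta> (matrix_inv m) \<in> coset g (\<theta> ` M)"
        using MD(6)[OF m(1)] by (intro cosetI imageI)
      ultimately show "z \<in> ?Z" by (rule image_eqI)
    next
      fix z assume "z \<in> ?Z"
      then obtain m where m: "m \<in> M" "z = g ** \<theta> m ** matrix_inv (\<theta> x)" by (auto elim: cosetE)
      have mG: "m \<in> G" using m MD(4) by blast
      have "z = y ** (\<theta> x ** \<theta> m ** matrix_inv (\<theta> x))" using m(2) y(2) by (simp add: assoc)
      then have zY: "z \<in> ?Y" using right[OF m(1) y(1)] by simp
      have "matrix_inv z ** g = \<theta> x ** \<theta> (matrix_inv m)"
        using m(2) gG x mG by (simp add: assoc)
      also have "\<dots> = \<theta> (x ** matrix_inv m)" using x mG by simp
      finally have "matrix_inv z ** g \<in> \<theta> ` coset x M"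
        using cosetI[OF MD(6)[OF m(1)], of x] by (rule image_eqI)
      then show "z \<in> {z \<in> G. z \<in> ?Y \<and> matrix_inv z ** g \<in> \<theta> ` coset x M}"
        using zY YG by auto
    qed
    moreover have "\<mu> ?Z = \<mu> M"
      using mu_right[OF open_compact_coset[OF open_compact_theta[OF ocM] gG], of "matrix_inv (\<theta> x)"] x
        mu_left[OF open_compact_theta[OF ocM] gG] mu_theta[OF M(1) MP] by simp
    ultimately show ?thesis using True gG by (simp add: convol_indicator)
  next
    case False
    have "{z \<in> G. z \<in> ?Y \<and> matrix_inv z ** g \<in> \<theta> ` coset x M} = {}"
    proof (rule equals0I)
      fix z assume "z \<in> {z \<in> G. z \<in> ?Y \<and> matrix_inv z ** g \<in> \<theta> ` coset x M}"
      then have z: "z \<in> G" "z \<in> ?Y" "matrix_inv z ** g \<in> coset (\<theta> x) (\<theta> ` M)"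
        using theta_coset[OF M(1) x] by auto
      obtain m where m: "m \<in> M" "matrix_inv z ** g = \<theta> x ** \<theta> m"
        using z(3) by (auto elim: cosetE)
      have "g = z ** (\<theta> x ** \<theta> m)" using m(2) z(1) by (metis inv_r')
      then have "g = z ** (\<theta> x ** \<theta> m ** matrix_inv (\<theta> x)) ** \<theta> x"
        using x by (simp add: assoc)
      then show False using False right[OF m(1) z(2)] by blast
    qed
    from convol_indicator_zero[OF this] show ?thesis using False by simp
  qed
  have "\<forall>y\<in>coset x M. \<omega> y = \<omega> x"
  proof
    fix y assume "y \<in> coset x M"
    then obtain m where m: "m \<in> M" "y = x ** m" by (rule cosetE)
    have "\<omega> m = 1" using m M(2) by (auto simp: W_def)
    then show "\<omega> y = \<omega> x"
      using m MD(4) x smooth_char by (simp add: is_smooth_char_def)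
  qed
  then have "(\<lambda>g. convol D \<mu> (indicator (coset x M)) (indicator ?Y) g -
      \<omega> (matrix_inv x) * convol D \<mu> (indicator ?Y) (indicator (\<theta> ` coset x M)) g) \<in> N"
    unfolding commutator_span_def
    by (intro R.span_base CollectI exI[of _ "coset x M"] exI[of _ ?Y] exI[of _ x] conjI refl
        open_compact_coset[OF ocM x] ocY mem_coset_self[OF M(1)])
  then have in_N: "(\<lambda>g. ?m * indicator (coset x ?Y) g -
      \<omega> (matrix_inv x) * (?m * indicator ((\<lambda>y. y ** \<theta> x) ` ?Y) g)) \<in> N"
    by (simp only: first second)
  obtain u where u: "u * ?m = 1" using of_Zp_inv_mu_unit[OF M(1) MP] ..
  have um: "u * (?m * r) = r" for r using u by (metis mult.assoc mult_1_left)
  have "scale u (\<lambda>g. ?m * indicator (coset x ?Y) g -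
      \<omega> (matrix_inv x) * (?m * indicator ((\<lambda>y. y ** \<theta> x) ` ?Y) g)) =
      (\<lambda>g. indicator (coset x ?Y) g - \<omega> (matrix_inv x) * indicator ((\<lambda>y. y ** \<theta> x) ` ?Y) g)"
    by (simp add: right_diff_distrib um mult.left_commute[of u "\<omega> (matrix_inv x)"])
  then show ?thesis using R.subspace_scale[OF subspace_N in_N, of u] by simp
qed


abbreviation hecke_group :: "(('k, 'n) sqmat \<Rightarrow> 'r) monoid" where "hecke_group \<equiv> hecke_add D"
abbreviation cocenter_group where "cocenter_group \<equiv> cocenter D \<mu> \<omega>"

definition cocenter_class :: "(('k, 'n) sqmat \<Rightarrow> 'r) \<Rightarrow> (('k, 'n) sqmat \<Rightarrow> 'r) set" where
  "cocenter_class f = N #>\<^bsub>hecke_group\<^esub> f"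

lemma hecke_group_simps [simp]:
  "carrier hecke_group = hecke D" "\<one>\<^bsub>hecke_group\<^esub> = 0" "f \<otimes>\<^bsub>hecke_group\<^esub> h = f + h"
  by (simp_all add: hecke_add_def)

lemma comm_group_hecke: "comm_group hecke_group"
proof (rule comm_groupI)
  fix f assume "f \<in> carrier hecke_group"
  then show "\<exists>h\<in>carrier hecke_group. h \<otimes>\<^bsub>hecke_group\<^esub> f = \<one>\<^bsub>hecke_group\<^esub>"
    using R.subspace_neg[OF subspace_hecke] by (intro bexI[of _ "- f"]) simp_all
qed (simp_all add: R.subspace_add[OF subspace_hecke] R.subspace_0[OF subspace_hecke] add_ac)

lemma inv_hecke_group: "f \<in> hecke D \<Longrightarrow> inv\<^bsub>hecke_group\<^esub> f = - f"
  using R.subspace_neg[OF subspace_hecke]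
  by (intro group.inv_equality[OF comm_group.axioms(2)[OF comm_group_hecke]]) simp_all

lemma subgroup_subspace:
  assumes "R.subspace M" "M \<subseteq> hecke D" shows "subgroup M hecke_group"
proof (rule group.subgroupI[OF comm_group.axioms(2)[OF comm_group_hecke]])
  show "M \<noteq> {}" using R.subspace_0[OF assms(1)] by blast
  show "inv\<^bsub>hecke_group\<^esub> a \<in> M" if "a \<in> M" for a
    using that assms(2) R.subspace_neg[OF assms(1)] by (auto simp: inv_hecke_group)
qed (use assms R.subspace_add[OF assms(1)] in auto)

lemma normal_N: "N \<lhd> hecke_group"
  using subgroup_subspace[OF subspace_N N_subset_hecke]
  by (simp add: comm_group.normal_iff_subgroup[OF comm_group_hecke])

lemma group_cocenter: "group cocenter_group"
  unfolding cocenter_def by (rule normal.factorgroup_is_group[OF normal_N])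

lemma cocenter_class_hom: "cocenter_class \<in> hom hecke_group cocenter_group"
  unfolding cocenter_def cocenter_class_def[abs_def] by (rule normal.r_coset_hom_Mod[OF normal_N])

lemma cocenter_class_add:
  "f \<in> hecke D \<Longrightarrow> h \<in> hecke D \<Longrightarrow>
    cocenter_class (f + h) = cocenter_class f \<otimes>\<^bsub>cocenter_group\<^esub> cocenter_class h"
  using hom_mult[OF cocenter_class_hom, of f h] by simp

lemma cocenter_class_zero: "cocenter_class 0 = \<one>\<^bsub>cocenter_group\<^esub>"
  using group_hom.hom_one[of hecke_group cocenter_group cocenter_class] cocenter_class_hom
    group_cocenter comm_group.axioms(2)[OF comm_group_hecke]
  by (simp add: group_hom_def group_hom_axioms_def)

lemma cocenter_class_eqI:
  assumes f: "f \<in> hecke D" and h: "h \<in> hecke D" and d: "f - h \<in> N"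
  shows "cocenter_class f = cocenter_class h"
proof -
  have "f \<in> N #>\<^bsub>hecke_group\<^esub> h"
    unfolding r_coset_def using d by (auto intro!: bexI[of _ "f - h"])
  then show ?thesis
    unfolding cocenter_class_def
    using group.repr_independence[OF comm_group.axioms(2)[OF comm_group_hecke], of f N h]
      h subgroup_subspace[OF subspace_N N_subset_hecke] by simp
qed

lemma cocenter_supp_eq: "cocenter_supp D \<mu> \<omega> X = cocenter_class ` hecke_supp D X"
  unfolding cocenter_supp_def cocenter_class_def[abs_def] by (rule refl)

lemma subgroup_cocenter_supp: "subgroup (cocenter_supp D \<mu> \<omega> X) cocenter_group"
proof -
  have "group_hom hecke_group cocenter_group cocenter_class"
    using cocenter_class_hom group_cocenter comm_group.axioms(2)[OF comm_group_hecke]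
    by (simp add: group_hom_def group_hom_axioms_def)
  moreover have "subgroup (hecke_supp D X) hecke_group"
    by (rule subgroup_subspace[OF subspace_hecke_supp]) (auto simp: hecke_supp_def)
  ultimately show ?thesis
    unfolding cocenter_supp_eq by (rule group_hom.subgroup_img_is_subgroup)
qed

lemma cocenter_supp_mono: "X \<subseteq> Y \<Longrightarrow> cocenter_supp D \<mu> \<omega> X \<subseteq> cocenter_supp D \<mu> \<omega> Y"
  unfolding cocenter_supp_def by (rule image_mono) (auto simp: hecke_supp_def)


section \<open>Newton strata\<close>

text \<open>Elements of the Iwahori--Weyl group are cosets of \<open>Z\<^sub>0\<close> in \<open>N\<close>, that is, the sets of all
  their lifts.\<close>

lemma lift_in_G:
  assumes "w \<in> carrier (W_tilde D)" "g \<in> w" shows "g \<in> G"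
proof -
  have "w \<in> rcosets\<^bsub>GLn\<lparr>carrier := N_set D\<rparr>\<^esub> (Z0 D)"
    using assms(1) by (simp add: W_tilde_def FactGroup_def)
  then show ?thesis
    using assms(2) Z0_subset_G by (auto simp: rcosets_GLn N_set_def)
qed

text \<open>The double coset is a union of cosets of the open subgroup \<open>I\<close>.\<close>

lemma openin_double_coset:
  assumes "w \<in> carrier (W_tilde D)" shows "openin T (double_coset D w)"
proof (subst openin_subopen, intro ballI)
  fix u assume "u \<in> double_coset D w"
  then obtain i g j where u: "i \<in> I" "g \<in> w" "j \<in> I" "u = i ** g ** j"
    unfolding double_coset_def by (elim CollectE exE conjE)
  have "i ** g \<in> G"
    using lift_in_G[OF assms u(2)] subsetD[OF I_subset_G u(1)] by simp
  then have "openin T (coset (i ** g) I)"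
    by (rule openin_coset[OF open_subgroupD(1)[OF open_subgroup_I]])
  moreover have "u \<in> coset (i ** g) I"
    unfolding u(4) using u(3) by (rule cosetI)
  moreover have "coset (i ** g) I \<subseteq> double_coset D w"
  proof
    fix v assume "v \<in> coset (i ** g) I"
    then obtain k where "k \<in> I" "v = i ** g ** k" by (rule cosetE)
    then show "v \<in> double_coset D w"
      unfolding double_coset_def using u(1,2) by (intro CollectI exI conjI)
  qed
  ultimately show "\<exists>U. openin T U \<and> u \<in> U \<and> U \<subseteq> double_coset D w"
    by (intro exI conjI)
qed

lemma double_coset_subset_stratum:
  assumes "w \<in> W_min D" "newton_pi D w = \<nu>"
  shows "double_coset D w \<subseteq> newton_stratum D \<nu>"
proof
  fix u assume "u \<in> double_coset D w"
  then have "u \<in> X_nu D \<nu>" using assms by (auto simp: X_nu_def)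
  moreover have "u = mat 1 ** u ** matrix_inv (\<theta> (mat 1))" by simp
  ultimately show "u \<in> newton_stratum D \<nu>"
    unfolding newton_stratum_def by (intro CollectI exI[of _ "mat 1"] exI[of _ u] conjI G_one)
qed

definition twisted_preimage :: "('k, 'n) sqmat \<Rightarrow> ('k, 'n) sqmat set \<Rightarrow> ('k, 'n) sqmat set" where
  "twisted_preimage x X = {h \<in> G. matrix_inv x ** h ** \<theta> x \<in> X}"

text \<open>Moving \<open>g\<close> into \<open>I w I\<close> by twisted conjugation also moves all points near \<open>g\<close> there, since
  twisted conjugation is continuous and \<open>I w I\<close> is open.\<close>

lemma newton_stratum_neighbourhood:
  assumes "g \<in> newton_stratum D \<nu>"
  obtains x w where "x \<in> G" "w \<in> W_min D" "newton_pi D w = \<nu>"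
    "openin T (twisted_preimage x (double_coset D w))"
    "g \<in> twisted_preimage x (double_coset D w)"
proof -
  obtain x u where x: "x \<in> G" "u \<in> X_nu D \<nu>" "g = x ** u ** matrix_inv (\<theta> x)"
    using assms by (auto simp: newton_stratum_def)
  obtain w where w: "w \<in> W_min D" "newton_pi D w = \<nu>" "u \<in> double_coset D w"
    using x(2) by (auto simp: X_nu_def)
  have dc: "openin T (double_coset D w)"
    using openin_double_coset w(1) by (simp add: W_min_def)
  let ?c = "(\<lambda>y. y ** \<theta> x) \<circ> (**) (matrix_inv x)"
  have "continuous_map T T ?c"
    using x(1) continuous_map_compose[OF continuous_translate_left continuous_translate_right] by simp
  from openin_continuous_map_preimage[OF this dc]
  have "openin T (twisted_preimage x (double_coset D w))" by (simp add: twisted_preimage_def)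
  moreover have "g \<in> twisted_preimage x (double_coset D w)"
    using x w(3) openin_G_subset[OF dc] by (simp add: twisted_preimage_def assoc)
  ultimately show thesis using that x(1) w(1,2) by blast
qed

lemma coset_coset: "coset x (coset y K) = coset (x ** y) K"
  by (simp add: coset_def image_image matrix_mul_assoc)

lemma scale_diff: "scale c f - scale (c * d) h = scale c (\<lambda>g. f g - d * h g)"
  by (rule ext) (simp only: minus_apply right_diff_distrib mult.assoc)

text \<open>A multiple of the characteristic function of \<open>s K\<close> is congruent to one of the characteristic
  function of \<open>x\<inverse> s K \<theta>(x)\<close>, and the latter set lies in \<open>X\<close>.\<close>

lemma cocenter_class_conjugate:
  assumes x: "x \<in> G" and s: "s \<in> G" and K: "open_subgroup K" "K \<subseteq> P"
    and X: "coset s K \<subseteq> twisted_preimage x X"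
  shows "cocenter_class (scale c (indicator (coset s K))) \<in> cocenter_supp D \<mu> \<omega> X"
proof -
  let ?Y = "coset (matrix_inv x ** s) K"
  let ?Z = "(\<lambda>y. y ** \<theta> x) ` ?Y"
  have sK: "coset x ?Y = coset s K"
    unfolding coset_coset using x by simp
  note ocK = open_compact_small[OF K]
  have "open_compact D ?Z"
    by (rule open_compact_translate_right[OF
          open_compact_coset[OF ocK G_mult[OF G_inv[OF x] s]] theta_G[OF x]])
  then have Z: "scale (c * \<omega> (matrix_inv x)) (indicator ?Z) \<in> hecke D"
    by (intro R.subspace_scale[OF subspace_hecke] indicator_hecke)
  have "?Z \<subseteq> X"
  proof
    fix z assume "z \<in> ?Z"
    then obtain y where y: "y \<in> ?Y" "z = y ** \<theta> x" by blast
    obtain k where k: "k \<in> K" "y = matrix_inv x ** s ** k" using y(1) by (rule cosetE)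
    have "s ** k \<in> twisted_preimage x X" using X cosetI[OF k(1)] by (rule subsetD)
    then show "z \<in> X" by (simp add: twisted_preimage_def y(2) k(2) assoc)
  qed
  have "g \<in> X" if nz: "c * \<omega> (matrix_inv x) * indicator ?Z g \<noteq> 0" for g
  proof (rule ccontr)
    assume "g \<notin> X"
    then have "indicator ?Z g = (0 :: 'r)" using \<open>?Z \<subseteq> X\<close> by (intro indicator_simps) blast
    with nz show False by simp
  qed
  with Z have "scale (c * \<omega> (matrix_inv x)) (indicator ?Z) \<in> hecke_supp D X"
    by (simp only: hecke_supp_def) blast
  moreover have "cocenter_class (scale c (indicator (coset s K))) =
      cocenter_class (scale (c * \<omega> (matrix_inv x)) (indicator ?Z))"
  proof (rule cocenter_class_eqI)
    show "scale c (indicator (coset s K)) \<in> hecke D"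
      using s by (intro R.subspace_scale[OF subspace_hecke] indicator_hecke open_compact_coset ocK)
    have "(\<lambda>g. indicator (coset s K) g - \<omega> (matrix_inv x) * indicator ?Z g) \<in> N"
      using twisted_translate_mod_N[OF x G_mult[OF G_inv[OF x] s] K] unfolding sK .
    note in_N = R.subspace_scale[OF subspace_N this, of c]
    show "scale c (indicator (coset s K)) -
        scale (c * \<omega> (matrix_inv x)) (indicator ?Z) \<in> N"
      unfolding scale_diff[of c "indicator (coset s K)" "\<omega> (matrix_inv x)" "indicator ?Z"]
      by (rule in_N)
  qed (rule Z)
  ultimately show ?thesis
    unfolding cocenter_supp_eq by (simp only: imageI)
qed

lemma cocenter_supp_newton_stratum:
  "cocenter_supp D \<mu> \<omega> (newton_stratum D \<nu>) =
    cocenter_sum D \<mu> \<omega> {w \<in> W_min D. newton_pi D w = \<nu>}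
      (\<lambda>w. cocenter_supp D \<mu> \<omega> (double_coset D w))"
  (is "_ = ?S")
proof (rule equalityI)
  show "?S \<subseteq> cocenter_supp D \<mu> \<omega> (newton_stratum D \<nu>)"
    unfolding cocenter_sum_def
  proof (rule group.generate_subgroup_incl[OF group_cocenter _ subgroup_cocenter_supp], rule UN_least)
    fix w assume "w \<in> {w \<in> W_min D. newton_pi D w = \<nu>}"
    then show "cocenter_supp D \<mu> \<omega> (double_coset D w) \<subseteq> cocenter_supp D \<mu> \<omega> (newton_stratum D \<nu>)"
      by (intro cocenter_supp_mono double_coset_subset_stratum) auto
  qed
next
  show "cocenter_supp D \<mu> \<omega> (newton_stratum D \<nu>) \<subseteq> ?S"
    unfolding cocenter_supp_eq[of "newton_stratum D \<nu>"]
  proof (rule image_subsetI)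
    fix f :: "('k, 'n) sqmat \<Rightarrow> 'r" assume fs: "f \<in> hecke_supp D (newton_stratum D \<nu>)"
    then have f: "f \<in> hecke D" and supp: "\<And>g. f g \<noteq> 0 \<Longrightarrow> g \<in> newton_stratum D \<nu>"
      by (auto simp: hecke_supp_def)
    have "\<exists>x w. x \<in> G \<and> w \<in> W_min D \<and> newton_pi D w = \<nu> \<and>
        openin T (twisted_preimage x (double_coset D w)) \<and> g \<in> twisted_preimage x (double_coset D w)"
      if "f g \<noteq> 0" for g
      using newton_stratum_neighbourhood[OF supp[OF that]] by blast
    then obtain x w where xw: "\<And>g. f g \<noteq> 0 \<Longrightarrow> x g \<in> G"
        "\<And>g. f g \<noteq> 0 \<Longrightarrow> w g \<in> W_min D \<and> newton_pi D (w g) = \<nu>"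
        "\<And>g. f g \<noteq> 0 \<Longrightarrow> openin T (twisted_preimage (x g) (double_coset D (w g))) \<and>
          g \<in> twisted_preimage (x g) (double_coset D (w g))"
      by metis
    define U where "U g = twisted_preimage (x g) (double_coset D (w g))" for g
    have "\<exists>K A. open_subgroup K \<and> K \<subseteq> P \<and> finite A \<and> A \<subseteq> G \<and>
        (\<forall>s\<in>A. \<exists>g. f g \<noteq> 0 \<and> coset s K \<subseteq> U g) \<and>
        f = (\<Sum>s\<in>A. (\<lambda>g. f s * indicator (coset s K) g))"
      by (rule hecke_coset_expansion[OF f open_subgroup_P]) (unfold U_def, rule xw(3))
    then obtain K A where K: "open_subgroup K" "K \<subseteq> P" and A: "finite A" "A \<subseteq> G"
        "\<forall>s\<in>A. \<exists>g. f g \<noteq> 0 \<and> coset s K \<subseteq> U g"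
        and f_eq: "f = (\<Sum>s\<in>A. (\<lambda>g. f s * indicator (coset s K) g))"
      by (elim exE conjE) (rule that)
    have summand: "cocenter_class (scale (f s) (indicator (coset s K))) \<in> ?S" if s: "s \<in> A" for s
    proof -
      obtain g where g: "f g \<noteq> 0" "coset s K \<subseteq> twisted_preimage (x g) (double_coset D (w g))"
        using bspec[OF A(3) s] unfolding U_def by blast
      have "cocenter_class (scale (f s) (indicator (coset s K))) \<in>
          cocenter_supp D \<mu> \<omega> (double_coset D (w g))"
        using cocenter_class_conjugate[OF xw(1)[OF g(1)] _ K g(2)] s A(2) by blast
      then show ?thesis
        unfolding cocenter_sum_def using xw(2)[OF g(1)] by (intro generate.incl) blast
    qed
    have hecke: "scale (f s) (indicator (coset s K)) \<in> hecke D" if "s \<in> A" for s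
      using that A(2) open_compact_small[OF K]
      by (intro R.subspace_scale[OF subspace_hecke] indicator_hecke open_compact_coset) auto
    have "cocenter_class (\<Sum>s\<in>B. scale (f s) (indicator (coset s K))) \<in> ?S" if "finite B" "B \<subseteq> A" for B
      using that
    proof (induction B)
      case empty
      show ?case
        unfolding cocenter_sum_def sum.empty cocenter_class_zero by (rule generate.one)
    next
      case (insert s B)
      then have B: "(\<Sum>s\<in>B. scale (f s) (indicator (coset s K))) \<in> hecke D"
        using hecke by (intro R.subspace_sum[OF subspace_hecke]) blast
      have s: "s \<in> A" using insert.prems by blast
      have IH: "cocenter_class (\<Sum>s\<in>B. scale (f s) (indicator (coset s K))) \<in> ?S"
        using insert.IH insert.prems by blast
      show ?case
        unfolding sum.insert[OF insert.hyps] cocenter_class_add[OF hecke[OF s] B]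
        using summand[OF s] IH unfolding cocenter_sum_def by (rule generate.eng)
    qed
    note sum_in_S = this[OF A(1) subset_refl]
    have "cocenter_class f = cocenter_class (\<Sum>s\<in>A. scale (f s) (indicator (coset s K)))"
      using f_eq by (rule arg_cong)
    also have "\<dots> \<in> ?S" by (rule sum_in_S)
    finally show "cocenter_class f \<in> ?S" .
  qed
qed

end

theorem corollary4p2:
  fixes D :: "('k::alg_closed_field, 'n::finite) padic_datum"
    and P :: "('k, 'n) sqmat set"
    and \<mu> :: "('k, 'n) sqmat set \<Rightarrow> rat"
    and \<omega> :: "('k, 'n) sqmat \<Rightarrow> 'r::comm_ring_1"
    and \<nu> :: "('k, 'n) sqmat set set \<times> ('k, 'n) cochar_space"
  assumes "is_padic_datum D"
    and "is_twist D"
    and "is_pro_p_iwahori D P"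
    and "is_haar D P \<mu>"
    and "\<exists>r::'r. of_nat (residue_char D) * r = 1"
    and "is_smooth_char D \<omega>"
    and "\<nu> \<in> aleph D"
  shows "cocenter_supp D \<mu> \<omega> (newton_stratum D \<nu>) =
    cocenter_sum D \<mu> \<omega> {w \<in> W_min D. newton_pi D w = \<nu>}
      (\<lambda>w. cocenter_supp D \<mu> \<omega> (double_coset D w))"
proof -
  interpret hecke_setting D P \<mu> \<omega>
    using assms by unfold_locales
  show ?thesis by (rule cocenter_supp_newton_stratum)
qed

end
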